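(* Let $K$ be a ring and $a\in K$. The monogenic ring $\mathbb{Z}\langle a\rangle$ is finitely separable if and only if there exist integers $k,n,k_1,\dots,k_{n-1}$ with $n>0$ and $k>0$ square-free (i.e. $k=1$ or $k$ is a product of distinct primes) such that $$k\,(a^{n}+k_1a^{n-1}+k_2a^{n-2}+\dots+k_{n-1}a)=0 .$$
   Context: Rings are associative and not necessarily unital or commutative. A ring $K$ is finitely separable if for every element $a\in K$ and every subring $A\subseteq K$ with $a\notin A$ there exist a finite ring $F$ and a ring homomorphism $\varphi:K\to F$ with $\varphi(a)\notin\varphi(A)$. For $a\in K$, $\mathbb{Z}\langle a\rangle$ denotes the subring generated by $a$, i.e. $\{g(a): g\in\mathbb{Z}[x],\ g(0)=0\}$; such rings are called monogenic. *)

theory Defs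
  imports "HOL-Computational_Algebra.Squarefree"
begin

definition subring_of :: "'a::ring set \<Rightarrow> bool" where
  "subring_of A \<longleftrightarrow> 0 \<in> A \<and> (\<forall>x\<in>A. \<forall>y\<in>A. x + y \<in> A \<and> x - y \<in> A \<and> x * y \<in> A)"

definition zgen :: "'a::ring \<Rightarrow> 'a set" where
  "zgen a = \<Inter>{A. subring_of A \<and> a \<in> A}"

text \<open>Positive powers in a possibly non-unital ring: apow a n = a^n for n >= 1
  (apow a 0 = 0 is a junk value, never used).\<close>
fun apow :: "'a::ring \<Rightarrow> nat \<Rightarrow> 'a" where
  "apow a 0 = 0"
| "apow a (Suc 0) = a"
| "apow a (Suc (Suc n)) = a * apow a (Suc n)"

definition zsc :: "int \<Rightarrow> 'a::ring \<Rightarrow> 'a" where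
  "zsc k x = (if 0 \<le> k then (((+) x) ^^ nat k) 0 else - ((((+) x) ^^ nat (- k)) 0))"

text \<open>A finite ring, represented (up to isomorphism, which is harmless since it is
  finite) on a finite carrier of natural numbers with addition and multiplication.\<close>
definition finite_ring_on :: "nat set \<Rightarrow> (nat \<Rightarrow> nat \<Rightarrow> nat) \<Rightarrow> (nat \<Rightarrow> nat \<Rightarrow> nat) \<Rightarrow> bool" where
  "finite_ring_on C ad mu \<longleftrightarrow> finite C
    \<and> (\<forall>x\<in>C. \<forall>y\<in>C. ad x y \<in> C \<and> mu x y \<in> C)
    \<and> (\<forall>x\<in>C. \<forall>y\<in>C. \<forall>z\<in>C. ad (ad x y) z = ad x (ad y z))
    \<and> (\<forall>x\<in>C. \<forall>y\<in>C. ad x y = ad y x)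
    \<and> (\<exists>e\<in>C. (\<forall>x\<in>C. ad e x = x) \<and> (\<forall>x\<in>C. \<exists>y\<in>C. ad x y = e))
    \<and> (\<forall>x\<in>C. \<forall>y\<in>C. \<forall>z\<in>C. mu (mu x y) z = mu x (mu y z))
    \<and> (\<forall>x\<in>C. \<forall>y\<in>C. \<forall>z\<in>C. mu x (ad y z) = ad (mu x y) (mu x z))
    \<and> (\<forall>x\<in>C. \<forall>y\<in>C. \<forall>z\<in>C. mu (ad x y) z = ad (mu x z) (mu y z))"

definition ring_hom_into :: "'a::ring set \<Rightarrow> ('a \<Rightarrow> nat) \<Rightarrow> nat set \<Rightarrow> (nat \<Rightarrow> nat \<Rightarrow> nat) \<Rightarrow> (nat \<Rightarrow> nat \<Rightarrow> nat) \<Rightarrow> bool" where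
  "ring_hom_into S f C ad mu \<longleftrightarrow> (\<forall>x\<in>S. f x \<in> C)
    \<and> (\<forall>x\<in>S. \<forall>y\<in>S. f (x + y) = ad (f x) (f y) \<and> f (x * y) = mu (f x) (f y))"

definition finitely_separable :: "'a::ring set \<Rightarrow> bool" where
  "finitely_separable S \<longleftrightarrow>
    (\<forall>b\<in>S. \<forall>A. subring_of A \<and> A \<subseteq> S \<and> b \<notin> A \<longrightarrow>
      (\<exists>C ad mu f. finite_ring_on C ad mu \<and> ring_hom_into S f C ad mu \<and> f b \<notin> f ` A))"

end

(* Write P for the ring of integer polynomials; g |-> a g(a) maps P onto zgen a, and the subrings of
zgen a correspond to the additive subgroups A of P that contain the kernel I and are closed under
(u, v) |-> x u v. Finite separability says that each such A is closed in the profinite topology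
of P. The condition on the right says that k f lies in I for a monic f and a squarefree k.

If k f lies in I, suppose that b is in A + J for all ideals J of finite index. It is enough to find, for
every prime p, an integer n prime to p with n b in A. Krull's intersection theorem over the integers
reduces this to the subgroup W = A + p^m P. Since k is squarefree, some polynomial h with
h W <= W and h(0) = 0 is nonzero modulo p: take x g with g in A, or x f if A <= p P. Krull's
theorem over the ring of multipliers of W, applied to h and then to some r = 1 - h rho, gives b in W.

Conversely, the subgroups between p^2 P + I and p P + I are subrings, and if they are all closed, then
p f lies in p^2 P + I for some monic f. Hence I contains some h with leading coefficient c > 0, and the
closed subring generated by c a contains c^N times everything for some N; it is spanned by finitely many
powers of c a modulo I, so that c^N f lies in I for some monic f. If p^2 divides this factor, a
relation p f in p^2 P + I allows to replace it by its quotient by p, so a minimal factor is squarefree. *)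
theory Submission
  imports Defs "HOL-Computational_Algebra.Polynomial_Factorial"
begin

section \<open>Submodules and Krull's intersection theorem\<close>

definition add_subgroup :: "'a::ab_group_add set \<Rightarrow> bool" where
  "add_subgroup A \<longleftrightarrow> 0 \<in> A \<and> (\<forall>u\<in>A. \<forall>v\<in>A. u - v \<in> A)"

lemma add_subgroup_zero: "add_subgroup A \<Longrightarrow> 0 \<in> A"
  and add_subgroup_diff: "add_subgroup A \<Longrightarrow> u \<in> A \<Longrightarrow> v \<in> A \<Longrightarrow> u - v \<in> A"
  by (auto simp: add_subgroup_def)

lemma add_subgroup_uminus: "add_subgroup A \<Longrightarrow> u \<in> A \<Longrightarrow> - u \<in> A"
  by (metis add_subgroup_diff add_subgroup_zero diff_0)

lemma add_subgroup_add: "add_subgroup A \<Longrightarrow> u \<in> A \<Longrightarrow> v \<in> A \<Longrightarrow> u + v \<in> A"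
  by (metis add_subgroup_diff add_subgroup_uminus diff_minus_eq_add)

lemma add_subgroup_add_iff: "add_subgroup A \<Longrightarrow> v \<in> A \<Longrightarrow> u + v \<in> A \<longleftrightarrow> u \<in> A"
  by (metis add_subgroup_add add_subgroup_diff add_diff_cancel_right')

lemma add_subgroup_of_int:
  fixes A :: "'a::comm_ring_1 set"
  assumes "add_subgroup A" "u \<in> A"
  shows "of_int n * u \<in> A"
proof (induction n rule: int_induct[where k = 0])
  case base
  then show ?case using assms by (simp add: add_subgroup_zero)
next
  case (step1 i)
  then show ?case using assms by (simp add: distrib_right add_subgroup_add)
next
  case (step2 i)
  then show ?case using assms by (simp add: left_diff_distrib add_subgroup_diff)
qed

text \<open>\<open>R\<close> is an arbitrary set of multipliers, so that one notion serves for
  abelian groups (\<open>R\<close> the integers), for modules over the multiplier ring of a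
  subgroup, and for ideals (\<open>R = UNIV\<close>).\<close>

definition submod :: "'a::comm_ring_1 set \<Rightarrow> 'a set \<Rightarrow> bool" where
  "submod R C \<longleftrightarrow> add_subgroup C \<and> (\<forall>\<rho>\<in>R. \<forall>z\<in>C. \<rho> * z \<in> C)"

lemma submod_add_subgroup: "submod R C \<Longrightarrow> add_subgroup C"
  and submod_mult: "submod R C \<Longrightarrow> \<rho> \<in> R \<Longrightarrow> z \<in> C \<Longrightarrow> \<rho> * z \<in> C"
  by (auto simp: submod_def)

lemma submod_power: "submod R C \<Longrightarrow> \<rho> \<in> R \<Longrightarrow> z \<in> C \<Longrightarrow> \<rho> ^ n * z \<in> C"
  by (induction n) (auto simp: mult.assoc submod_mult)

text \<open>The chain condition only says that a chain cannot increase at every step; Krull's theorem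
  needs no more.\<close>
definition noeth :: "'a::comm_ring_1 set \<Rightarrow> 'a set \<Rightarrow> bool" where
  "noeth R N \<longleftrightarrow> (\<forall>C. (\<forall>j. submod R (C j)) \<and> incseq C \<and> (\<forall>j. N \<subseteq> C j) \<longrightarrow> (\<exists>j. C (Suc j) \<subseteq> C j))"

lemma noethD:
  assumes "noeth R N" "\<And>j. submod R (C j)" "\<And>j. C j \<subseteq> C (Suc j)" "\<And>j. N \<subseteq> C j"
  shows "\<exists>j::nat. C (Suc j) \<subseteq> C j"
  using assms incseq_SucI[of C] unfolding noeth_def by blast

text \<open>Krull's intersection theorem for a principal ideal of \<open>R\<close>: once the chain of the modules
  \<open>{z. s y\<^sup>j z \<in> W + R s b}\<close> stops at \<open>j\<close>, expand \<open>s b\<close> modulo \<open>s y\<^sup>j\<^sup>+\<^sup>1\<close>.\<close>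
lemma krull_intersection:
  fixes W :: "'a::comm_ring_1 set"
  assumes noeth: "noeth R N"
    and R: "1 \<in> R" "\<And>u v. u \<in> R \<Longrightarrow> v \<in> R \<Longrightarrow> u * v \<in> R" "add_subgroup R" "y \<in> R"
    and W: "submod R W" and N: "\<And>z. z \<in> N \<Longrightarrow> s * z \<in> W"
    and b: "\<And>j. \<exists>w\<in>W. \<exists>z. s * b = w + s * y ^ j * z"
  shows "\<exists>\<rho>\<in>R. (1 - y * \<rho>) * (s * b) \<in> W"
proof -
  define C where "C j = {z. \<exists>\<rho>\<in>R. s * y ^ j * z - \<rho> * (s * b) \<in> W}" for j :: nat
  note Wg = submod_add_subgroup[OF W]
  have C: "submod R (C j)" for j
    unfolding submod_def add_subgroup_def
  proof (intro conjI ballI)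
    have "s * y ^ j * 0 - 0 * (s * b) \<in> W" using Wg by (simp add: add_subgroup_zero)
    then show "0 \<in> C j" unfolding C_def using R(3) add_subgroup_zero by blast
  next
    fix u v assume "u \<in> C j" "v \<in> C j"
    then obtain \<rho> \<sigma> where *: "\<rho> \<in> R" "\<sigma> \<in> R" "s * y ^ j * u - \<rho> * (s * b) \<in> W" "s * y ^ j * v - \<sigma> * (s * b) \<in> W"
      by (auto simp: C_def)
    have "s * y ^ j * (u - v) - (\<rho> - \<sigma>) * (s * b) \<in> W"
      using add_subgroup_diff[OF Wg *(3,4)] by (simp add: algebra_simps)
    then show "u - v \<in> C j" unfolding C_def using add_subgroup_diff[OF R(3) *(1,2)] by blast
  next
    fix \<sigma> z assume "\<sigma> \<in> R" "z \<in> C j"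
    then obtain \<rho> where *: "\<rho> \<in> R" "s * y ^ j * z - \<rho> * (s * b) \<in> W" by (auto simp: C_def)
    have "s * y ^ j * (\<sigma> * z) - (\<sigma> * \<rho>) * (s * b) \<in> W"
      using submod_mult[OF W \<open>\<sigma> \<in> R\<close> *(2)] by (simp add: algebra_simps)
    then show "\<sigma> * z \<in> C j" unfolding C_def using R(2) * \<open>\<sigma> \<in> R\<close> by blast
  qed
  have mono: "C j \<subseteq> C (Suc j)" for j
  proof
    fix z assume "z \<in> C j"
    then obtain \<rho> where *: "\<rho> \<in> R" "s * y ^ j * z - \<rho> * (s * b) \<in> W" by (auto simp: C_def)
    have "s * y ^ Suc j * z - (y * \<rho>) * (s * b) \<in> W"
      using submod_mult[OF W \<open>y \<in> R\<close> *(2)] by (simp add: algebra_simps)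
    then show "z \<in> C (Suc j)" unfolding C_def using R * by blast
  qed
  have "N \<subseteq> C j" for j
  proof
    fix z assume "z \<in> N"
    have "s * y ^ j * z - 0 * (s * b) \<in> W"
      using submod_power[OF W \<open>y \<in> R\<close> N[OF \<open>z \<in> N\<close>]] by (simp add: algebra_simps)
    then show "z \<in> C j" unfolding C_def using R(3) add_subgroup_zero by blast
  qed
  then obtain j where j: "C (Suc j) \<subseteq> C j"
    using noethD[where C = C, OF noeth C mono] by blast
  obtain w z where w: "w \<in> W" "s * b = w + s * y ^ Suc j * z" using b by blast
  \<comment> \<open>The expansion of s b puts z into C (j+1) with coefficient 1; stability moves it
    into C j, which trades s y^j z for a multiple \<rho> s b modulo W.\<close>
  have "s * y ^ Suc j * z - 1 * (s * b) = - w" using w by (simp add: algebra_simps)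
  then have "z \<in> C (Suc j)" unfolding C_def using R(1) add_subgroup_uminus[OF Wg w(1)] by force
  with j obtain \<rho> where \<rho>: "\<rho> \<in> R" "s * y ^ j * z - \<rho> * (s * b) \<in> W" by (auto simp: C_def)
  have "(1 - y * \<rho>) * (s * b) = w + s * y ^ Suc j * z - y * \<rho> * (s * b)"
    using w(2) by (simp add: algebra_simps)
  also have "\<dots> = w + y * (s * y ^ j * z - \<rho> * (s * b))"
    by (simp add: algebra_simps)
  finally have "(1 - y * \<rho>) * (s * b) = w + y * (s * y ^ j * z - \<rho> * (s * b))" .
  then show ?thesis
    using \<rho> add_subgroup_add[OF Wg w(1) submod_mult[OF W R(4) \<rho>(2)]] by (metis (lifting))
qed

text \<open>A factor r can be cancelled in s r b \<in> W. Once the chain {z. s r^(j+1) z \<in> W}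
  stops at j, expand b = w + r^(j+1) z: then s r b \<in> W gives s r^(j+2) z \<in> W, hence s
  r^(j+1) z \<in> W and s b \<in> W.\<close>

lemma krull_intersection_torsion:
  fixes W :: "'a::comm_ring_1 set"
  assumes noeth: "noeth R N"
    and W: "submod R W" and "r \<in> R" "s \<in> R" and N: "\<And>z. z \<in> N \<Longrightarrow> s * r * z \<in> W"
    and b: "\<And>j. \<exists>w\<in>W. \<exists>z. b = w + r ^ j * z" and tors: "s * r * b \<in> W"
  shows "s * b \<in> W"
proof -
  define C where "C j = {z. s * r ^ Suc j * z \<in> W}" for j :: nat
  note Wg = submod_add_subgroup[OF W]
  have C: "submod R (C j)" for j
    unfolding submod_def add_subgroup_def C_def
    using Wg submod_mult[OF W]
    by (auto simp: right_diff_distrib add_subgroup_zero add_subgroup_diff mult.left_commute)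
  have mono: "C j \<subseteq> C (Suc j)" for j
    unfolding C_def using submod_mult[OF W \<open>r \<in> R\<close>] by (fastforce simp: mult.assoc mult.left_commute)
  have "N \<subseteq> C j" for j
    unfolding C_def using submod_power[OF W \<open>r \<in> R\<close> N, of _ j] by (auto simp: algebra_simps)
  then obtain j where j: "C (Suc j) \<subseteq> C j"
    using noethD[where C = C, OF noeth C mono] by blast
  obtain w z where w: "w \<in> W" "b = w + r ^ Suc j * z" using b by blast
  have sw: "s * w \<in> W" using submod_mult[OF W \<open>s \<in> R\<close> w(1)] .
  have "r * (s * w) \<in> W" using submod_mult[OF W \<open>r \<in> R\<close> sw] .
  moreover have "s * r * b = r * (s * w) + s * r ^ Suc (Suc j) * z"
    using w(2) by (simp add: algebra_simps)
  ultimately have "s * r ^ Suc (Suc j) * z \<in> W"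
    using tors add_subgroup_diff[OF Wg] by (metis add_diff_cancel_left')
  then have "s * r ^ Suc j * z \<in> W" using j by (auto simp: C_def)
  moreover have "s * b = s * w + s * r ^ Suc j * z" using w(2) by (simp add: algebra_simps)
  ultimately show ?thesis using add_subgroup_add[OF Wg sw] by simp
qed

section \<open>Chain conditions for integer polynomials\<close>

text \<open>For a monic divisor pseudo-division is division. Bounding the remainder by its
  coefficients also covers constant f, where it must vanish.\<close>

lemma monic_division:
  fixes f g :: "'a::idom poly"
  assumes "lead_coeff f = 1"
  obtains q r where "g = q * f + r" "\<And>i. degree f \<le> i \<Longrightarrow> coeff r i = 0"
proof -
  obtain q r where qr: "pseudo_divmod g f = (q, r)" by fastforce
  have "f \<noteq> 0" using assms by auto
  then have "g = q * f + r" "r = 0 \<or> degree r < degree f"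
    using pseudo_divmod[OF \<open>f \<noteq> 0\<close> qr] assms by (auto simp: mult.commute)
  then show ?thesis using that[of q r] by (metis coeff_0 coeff_eq_0 less_le_trans)
qed

lemma of_int_poly_dvd_iff: "of_int p dvd (g :: int poly) \<longleftrightarrow> (\<forall>i. p dvd coeff g i)"
  by (simp add: of_int_poly const_poly_dvd_iff)

lemma coeff_of_int_mult [simp]: "coeff (of_int n * g) i = n * coeff (g :: int poly) i"
  by (simp add: of_int_poly)

lemma degree_of_int_mult_le: "degree (of_int n * g) \<le> degree (g :: int poly)"
  by (simp add: of_int_poly degree_smult_le)

lemma ex_inverse_mod_prime:
  fixes p c :: int
  assumes "prime p" "\<not> p dvd c"
  obtains u t where "u * c = 1 + p * t" "coprime u p"
proof -
  have "coprime p c" using assms by (simp add: prime_imp_coprime)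
  then obtain u v where "u * p + v * c = 1" using coprime_iff_gcd_eq_1 bezout_int by metis
  then have *: "v * c = 1 + p * (- u)" by (simp add: algebra_simps)
  moreover have "coprime v p"
  proof (rule coprimeI)
    fix d assume "d dvd v" "d dvd p"
    then have "d dvd v * c - p * (-u)" by (intro dvd_diff) auto
    then show "is_unit d" using * by simp
  qed
  ultimately show ?thesis using that by blast
qed

text \<open>Take the top coefficient of g that is nonzero modulo p, scale it to 1 modulo p by u, and
  correct the rest by multiples of p. Since u is invertible modulo p, f and g generate the same
  ideal modulo p.\<close>

lemma monic_mod_prime:
  fixes g :: "int poly"
  assumes "prime p" "\<not> of_int p dvd g"
  obtains u w f where "of_int u * g = f + of_int p * w" "coprime u p" "lead_coeff f = 1"
    "degree f \<le> degree g" "\<And>i. \<not> p dvd coeff g i \<Longrightarrow> i \<le> degree f"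
proof -
  define d where "d = Max {i. \<not> p dvd coeff g i}"
  have sub: "{i. \<not> p dvd coeff g i} \<subseteq> {..degree g}"
    using coeff_eq_0[of g] by (force simp: not_le[symmetric])
  then have fin: "finite {i. \<not> p dvd coeff g i}" using finite_subset by blast
  have ne: "{i. \<not> p dvd coeff g i} \<noteq> {}" using assms(2) by (auto simp: of_int_poly_dvd_iff)
  have d: "\<not> p dvd coeff g d" using Max_in[OF fin ne] by (simp add: d_def)
  have dmax: "i \<le> d" if "\<not> p dvd coeff g i" for i using Max_ge[OF fin] that by (simp add: d_def)
  obtain u t where u: "u * coeff g d = 1 + p * t" "coprime u p"
    using ex_inverse_mod_prime[OF assms(1) d] by blast
  define f where "f = poly_cutoff d (of_int u * g) + monom 1 d"
  have cf: "coeff f i = (if i < d then u * coeff g i else if i = d then 1 else 0)" for i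
    by (simp add: f_def coeff_poly_cutoff)
  have deg: "degree f = d"
    by (rule antisym) (auto intro!: degree_le le_degree simp: cf)
  have "p dvd coeff (of_int u * g - f) i" for i
  proof -
    consider "i < d" | "i = d" | "i > d" by linarith
    then show ?thesis
    proof cases
      case 3
      then have "p dvd coeff g i" using dmax[of i] by linarith
      then show ?thesis using 3 by (simp add: cf)
    qed (use u in \<open>simp_all add: cf\<close>)
  qed
  then have "of_int p dvd of_int u * g - f" using of_int_poly_dvd_iff by blast
  then obtain w where "of_int u * g - f = of_int p * w" by (rule dvdE)
  then have "of_int u * g = f + of_int p * w" by (simp add: algebra_simps)
  moreover have "lead_coeff f = 1" using deg cf by simp
  moreover have "degree f \<le> degree g" using deg d sub by auto
  ultimately show ?thesis using that u(2) dmax deg by blast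
qed

section \<open>Increasing chains over the integers\<close>

lemma incseq_maxI1: "incseq C \<Longrightarrow> z \<in> C i \<Longrightarrow> z \<in> C (max i j)"
  and incseq_maxI2: "incseq C \<Longrightarrow> z \<in> C j \<Longrightarrow> z \<in> C (max i j)"
  by (meson incseqD max.cobounded1 max.cobounded2 subsetD)+

text \<open>The least positive integer occurring in any member generates all members, by division
  with remainder, so the chain is constant from its first appearance on.\<close>

lemma int_subgroup_chain:
  fixes L :: "nat \<Rightarrow> int set"
  assumes L: "\<And>j. add_subgroup (L j)" and inc: "incseq L"
  shows "\<exists>j. \<forall>i. L i \<subseteq> L j"
proof (cases "\<forall>i. L i \<subseteq> {0}")
  case True
  then show ?thesis using L add_subgroup_zero by (metis subset_singletonD empty_iff order_refl)
next
  case False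
  then obtain i0 x0 where x0: "x0 \<in> L i0" "x0 \<noteq> 0" by auto
  define Q where "Q n \<longleftrightarrow> n > 0 \<and> (\<exists>i. int n \<in> L i)" for n
  have "Q (nat \<bar>x0\<bar>)" using x0 add_subgroup_uminus[OF L x0(1)] 
    unfolding Q_def by (intro conjI exI[of _ i0]) (auto simp: abs_if)
  then have n: "Q (LEAST n. Q n)" by (rule LeastI)
  define n where "n = (LEAST n. Q n)"
  obtain j where j: "n > 0" "int n \<in> L j" using n by (auto simp: Q_def n_def)
  have "L i \<subseteq> L j" for i
  proof
    fix x assume x: "x \<in> L i"
    define M where "M = L (max i j)"
    have M: "x \<in> M" "int n \<in> M" using x j inc by (auto simp: M_def intro: incseq_maxI1 incseq_maxI2)
    have Mg: "add_subgroup M" using L by (simp add: M_def)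
    have "x mod int n = x - of_int (x div int n) * int n" by (simp add: minus_div_mult_eq_mod)
    then have mem: "x mod int n \<in> M"
      using add_subgroup_diff[OF Mg M(1) add_subgroup_of_int[OF Mg M(2)]] by metis
    have "x mod int n = 0"
    proof (rule ccontr)
      assume "x mod int n \<noteq> 0"
      then have pos: "x mod int n > 0" "x mod int n < int n" using j(1) by (auto simp: order.not_eq_order_implies_strict)
      then have "Q (nat (x mod int n))" using mem M_def by (auto simp: Q_def)
      then have "n \<le> nat (x mod int n)" unfolding n_def by (rule Least_le)
      then show False using pos by linarith
    qed
    then have "x = of_int (x div int n) * int n" using div_mult_mod_eq[of x "int n"] by simp
    then show "x \<in> L j" using add_subgroup_of_int[OF L j(2)] by metis
  qed
  then show ?thesis by blast
qed

text \<open>Induction as in Hilbert's basis theorem: the coefficients at d of the elements without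
  higher terms form a chain of subgroups of the integers. Where it stops, the term at d can be
  subtracted off, which leaves the case d.\<close>

lemma bounded_degree_chain:
  fixes C :: "nat \<Rightarrow> int poly set"
  assumes C: "\<And>j. add_subgroup (C j)" and inc: "incseq C"
  shows "\<exists>j. \<forall>i. \<forall>z\<in>C i. (\<forall>m\<ge>d. coeff z m = 0) \<longrightarrow> z \<in> C j"
proof (induction d)
  case 0
  then show ?case using C by (metis add_subgroup_zero coeff_0 le0 poly_eqI)
next
  case (Suc d)
  then obtain j1 where j1: "\<And>i z. z \<in> C i \<Longrightarrow> (\<And>m. m \<ge> d \<Longrightarrow> coeff z m = 0) \<Longrightarrow> z \<in> C j1" by blast
  define L where "L j = (\<lambda>z. coeff z d) ` {z\<in>C j. \<forall>m\<ge>Suc d. coeff z m = 0}" for j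
  have "add_subgroup (L j)" for j
    unfolding add_subgroup_def
  proof (intro conjI ballI)
    show "0 \<in> L j" unfolding L_def by (rule image_eqI[of _ _ 0]) (auto simp: add_subgroup_zero C)
  next
    fix u v assume "u \<in> L j" "v \<in> L j"
    then obtain y z where "y \<in> C j" "\<forall>m\<ge>Suc d. coeff y m = 0" "z \<in> C j" "\<forall>m\<ge>Suc d. coeff z m = 0"
      "u = coeff y d" "v = coeff z d" unfolding L_def by blast
    then show "u - v \<in> L j" unfolding L_def
      by (intro image_eqI[of _ _ "y - z"]) (auto simp: add_subgroup_diff C)
  qed
  moreover have "incseq L"
    using inc unfolding L_def incseq_def by blast
  ultimately obtain j2 where j2: "\<And>i. L i \<subseteq> L j2" using int_subgroup_chain by blast
  define j where "j = max j1 j2"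
  have sub: "C j1 \<subseteq> C j" "C j2 \<subseteq> C j" using inc by (auto simp: j_def incseq_def)
  show ?case
  proof (intro exI[of _ j] allI ballI impI)
    fix i z assume z: "z \<in> C i" "\<forall>m\<ge>Suc d. coeff z m = 0"
    then have "coeff z d \<in> L i" by (auto simp: L_def)
    then have "coeff z d \<in> L j2" using j2 by blast
    then obtain y where y: "y \<in> C j2" "\<forall>m\<ge>Suc d. coeff y m = 0" "coeff z d = coeff y d" unfolding L_def by blast
    have "z \<in> C (max i j)" "y \<in> C (max i j)" using z y sub inc by (auto intro: incseq_maxI1 incseq_maxI2)
    then have "z - y \<in> C (max i j)" using C add_subgroup_diff by blast
    moreover have "coeff (z - y) m = 0" if "m \<ge> d" for m
      using that z(2) y(2,3) by (cases "m = d") auto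
    ultimately have "z - y \<in> C j1" using j1 by blast
    then have "z - y \<in> C j" "y \<in> C j" using sub y by auto
    then show "z \<in> C j" using add_subgroup_add[OF C] by (metis diff_add_cancel)
  qed
qed

text \<open>Remainders modulo f represent all classes modulo the multiples of f, so only elements of
  degree below that of f matter.\<close>

lemma noeth_int:
  fixes f :: "int poly"
  assumes "lead_coeff f = 1"
  shows "noeth (range of_int) (range ((*) f))"
  unfolding noeth_def
proof (intro allI impI, elim conjE)
  fix C :: "nat \<Rightarrow> int poly set"
  assume C: "\<forall>j. submod (range of_int) (C j)" and inc: "incseq C" and N: "\<forall>j. range ((*) f) \<subseteq> C j"
  have Cg: "add_subgroup (C j)" for j using C submod_add_subgroup by blast
  obtain j where j: "\<And>i z. z \<in> C i \<Longrightarrow> (\<And>m. m \<ge> degree f \<Longrightarrow> coeff z m = 0) \<Longrightarrow> z \<in> C j"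
    using bounded_degree_chain[of C "degree f", OF Cg inc] by blast
  have "C (Suc j) \<subseteq> C j"
  proof
    fix z assume z: "z \<in> C (Suc j)"
    obtain q r where qr: "z = q * f + r" "\<And>i. degree f \<le> i \<Longrightarrow> coeff r i = 0"
      using monic_division[OF assms] by blast
    have qf: "q * f \<in> C i" for i using N by (metis mult.commute rangeI subsetD)
    have "r \<in> C (Suc j)" using z qr(1) qf add_subgroup_diff[OF Cg] by (metis add_diff_cancel_left')
    then have "r \<in> C j" using j qr(2) by blast
    then show "z \<in> C j" using qr(1) qf add_subgroup_add[OF Cg] by blast
  qed
  then show "\<exists>j. C (Suc j) \<subseteq> C j" by blast
qed

text \<open>Modulo \<open>p\<close> we may take \<open>h\<close> monic. Then a submodule is generated by monic elements of
  minimal degree, one for each residue class of degrees modulo the degree of \<open>h\<close>.\<close>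
lemma chain_mod_prime:
  fixes C :: "nat \<Rightarrow> int poly set"
  assumes p: "prime p" and h: "i0 > 0" "\<not> p dvd coeff h i0"
    and C: "\<And>j. add_subgroup (C j)" and inc: "incseq C"
    and Ch: "\<And>j z. z \<in> C j \<Longrightarrow> h * z \<in> C j" and Cp: "\<And>j z. of_int p * z \<in> C j"
  shows "\<exists>j. \<forall>i. C i \<subseteq> C j"
proof -
  have "\<not> of_int p dvd h" using h by (auto simp: of_int_poly_dvd_iff)
  then obtain u w f where f: "of_int u * h = f + of_int p * w" "lead_coeff f = 1" "i0 \<le> degree f"
    using monic_mod_prime[OF p] h(2) by metis
  define d where "d = degree f"
  \<comment> \<open>Positivity of \<open>i0\<close> excludes a constant f; for d = 0 there would be
    infinitely many residue classes.\<close>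
  have d: "d > 0" using f(3) h(1) by (simp add: d_def)
  have Cf: "f * z \<in> C j" if "z \<in> C j" for j z
  proof -
    have "of_int u * (h * z) \<in> C j" using that Ch C add_subgroup_of_int by blast
    moreover have "f * z = of_int u * (h * z) - of_int p * (w * z)"
      unfolding mult.assoc[symmetric] f(1) by (simp add: algebra_simps)
    ultimately show ?thesis using Cp add_subgroup_diff[OF C] by metis
  qed
  have Cfn: "f ^ n * z \<in> C j" if "z \<in> C j" for j z n
    using that by (induction n) (auto simp: mult.assoc Cf)
  \<comment> \<open>For each class k choose a stage containing a monic element whose degree is least
    in that class over the whole chain; for classes without monic elements the condition is
    vacuous.\<close>
  have "\<exists>J. \<forall>i z. z \<in> C i \<and> lead_coeff z = 1 \<and> degree z mod d = k \<longrightarrow>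
      (\<exists>w\<in>C J. lead_coeff w = 1 \<and> degree w mod d = k \<and> degree w \<le> degree z)" for k
  proof -
    define Q where "Q n \<longleftrightarrow> (\<exists>i. \<exists>z\<in>C i. lead_coeff z = 1 \<and> degree z mod d = k \<and> degree z = n)" for n
    show ?thesis
    proof (cases "\<exists>n. Q n")
      case True
      then have Q: "Q (LEAST n. Q n)" by (rule LeastI_ex)
      then obtain J w where w: "w \<in> C J" "lead_coeff w = 1" "degree w mod d = k" "degree w = (LEAST n. Q n)"
        unfolding Q_def[of "Least _"] by blast
      moreover have "degree w \<le> degree z" if "z \<in> C i" "lead_coeff z = 1" "degree z mod d = k" for i z
        unfolding w(4) using that by (intro Least_le) (auto simp: Q_def)
      ultimately show ?thesis by blast
    next
      case False
      then show ?thesis unfolding Q_def by blast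
    qed
  qed
  then obtain J where J: "\<And>k i z. z \<in> C i \<Longrightarrow> lead_coeff z = 1 \<Longrightarrow> degree z mod d = k \<Longrightarrow>
      \<exists>w\<in>C (J k). lead_coeff w = 1 \<and> degree w mod d = k \<and> degree w \<le> degree z"
    by metis
  define j where "j = Max (J ` {..<d})"
  have Jj: "C (J k) \<subseteq> C j" if "k < d" for k
    using that inc unfolding j_def by (intro incseqD[OF inc] Max_ge) auto
  \<comment> \<open>Induction on the degree: normalise z to a monic z' and cancel its leading term
    by w1 times a power of f, which is possible since the degrees of z' and w1 are congruent modulo
    d.\<close>
  have "z \<in> C j" if "z \<in> C i" for i z
    using that
  proof (induction "degree z" arbitrary: i z rule: less_induct)
    case less
    show ?case
    proof (cases "of_int p dvd z")
      case True
      then show ?thesis using Cp by (auto elim: dvdE)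
    next
      case False
      then obtain u w z' where z': "of_int u * z = z' + of_int p * w" "coprime u p" "lead_coeff z' = 1"
        "degree z' \<le> degree z" using monic_mod_prime[OF p] by metis
      have "z' = of_int u * z - of_int p * w" using z'(1) by simp
      then have z'i: "z' \<in> C i" using add_subgroup_of_int[OF C less(2)] Cp add_subgroup_diff[OF C] by metis
      obtain w1 where w1: "w1 \<in> C (J (degree z' mod d))" "lead_coeff w1 = 1"
        "degree w1 mod d = degree z' mod d" "degree w1 \<le> degree z'"
        using J[OF z'i z'(3)] by blast
      have w1j: "w1 \<in> C j" using w1(1) Jj d by (metis mod_less_divisor subsetD)
      obtain e where e: "degree z' = degree w1 + d * e"
        using w1(3,4) by (metis mod_eq_dvd_iff_nat le_add_diff_inverse dvdE)
      define y where "y = f ^ e * w1"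
      have y: "lead_coeff y = 1" "degree y = degree z'" "y \<in> C j"
      proof -
        have "f \<noteq> 0" "w1 \<noteq> 0" using f(2) w1(2) by auto
        then show "degree y = degree z'"
          unfolding y_def by (simp add: degree_mult_eq degree_power_eq e d_def mult.commute)
        show "lead_coeff y = 1" unfolding y_def by (simp add: lead_coeff_mult lead_coeff_power f w1)
        show "y \<in> C j" unfolding y_def by (rule Cfn[OF w1j])
      qed
      have "z' - y \<in> C j"
      proof (cases "z' - y = 0")
        case True
        then show ?thesis using add_subgroup_zero[OF C] by simp
      next
        case nz: False
        have "degree (z' - y) < degree z'"
        proof -
          have "coeff (z' - y) (degree z') = 0" using y z'(3) by simp
          then have "degree (z' - y) \<noteq> degree z'" using nz leading_coeff_0_iff by metis
          moreover have "degree (z' - y) \<le> degree z'" using y(2) by (intro degree_diff_le) auto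
          ultimately show ?thesis by linarith
        qed
        moreover have "z' - y \<in> C (max i j)"
          by (intro add_subgroup_diff[OF C] incseq_maxI1[OF inc z'i] incseq_maxI2[OF inc y(3)])
        ultimately show ?thesis using less(1) z'(4) by (metis less_le_trans)
      qed
      then have z'j: "z' \<in> C j" using y(3) add_subgroup_add[OF C] by (metis diff_add_cancel)
      then have uz: "of_int u * z \<in> C j" using z'(1) Cp add_subgroup_add[OF C] by metis
      \<comment> \<open>Bezout undoes the scaling by u, as multiples of p lie in C j anyway.\<close>
      obtain v t where "v * u + t * p = 1" using z'(2) coprime_iff_gcd_eq_1 bezout_int by metis
      then have "z = of_int (v * u + t * p) * z" by simp
      also have "\<dots> = of_int v * (of_int u * z) + of_int p * (of_int t * z)" by (simp add: algebra_simps)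
      finally show ?thesis using add_subgroup_add[OF C add_subgroup_of_int[OF C uz] Cp] by metis
    qed
  qed
  then show ?thesis by blast
qed

text \<open>Devissage along multiplication by p: D j = {z. p z \<in> C j} contains p^m P and falls
  under the induction hypothesis, B j = C j + p P under the case of exponent 1. If both chains are
  stationary, an element of C i agrees with one of C j up to some p w, and w is controlled by
  D.\<close>

lemma chain_mod_prime_power:
  fixes C :: "nat \<Rightarrow> int poly set"
  assumes p: "prime p" and h: "i0 > 0" "\<not> p dvd coeff h i0"
    and C: "\<And>j. add_subgroup (C j)" and inc: "incseq C"
    and Ch: "\<And>j z. z \<in> C j \<Longrightarrow> h * z \<in> C j" and Cp: "\<And>j z. of_int (p ^ m) * z \<in> C j"
  shows "\<exists>j. \<forall>i. C i \<subseteq> C j"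
  using C inc Ch Cp
proof (induction m arbitrary: C)
  case 0
  then show ?case by (auto simp: subset_iff)
next
  case (Suc m)
  note C = Suc.prems(1) and inc = Suc.prems(2) and Ch = Suc.prems(3) and Cp = Suc.prems(4)
  define D where "D j = {z. of_int p * z \<in> C j}" for j
  define B where "B j = {z. \<exists>w. z - of_int p * w \<in> C j}" for j
  have "\<exists>j. \<forall>i. D i \<subseteq> D j"
  proof (rule Suc.IH)
    show "add_subgroup (D j)" for j
      using C[of j] by (auto simp: D_def add_subgroup_def right_diff_distrib)
    show "incseq D" using inc by (auto simp: D_def incseq_def)
    show "h * z \<in> D j" if "z \<in> D j" for j z
      using Ch that unfolding D_def by (metis mem_Collect_eq mult.left_commute)
    show "of_int (p ^ m) * z \<in> D j" for j z
      using Cp[of z j] by (simp add: D_def mult.assoc)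
  qed
  then obtain j1 where j1: "\<And>i. D i \<subseteq> D j1" by blast
  have "\<exists>j. \<forall>i. B i \<subseteq> B j"
  proof (rule chain_mod_prime[OF p h])
    show "add_subgroup (B j)" for j
      unfolding add_subgroup_def
    proof (intro conjI ballI)
      show "0 \<in> B j" unfolding B_def using add_subgroup_zero[OF C] by (auto intro!: exI[of _ 0])
      fix u v assume "u \<in> B j" "v \<in> B j"
      then obtain w w' where "u - of_int p * w \<in> C j" "v - of_int p * w' \<in> C j" by (auto simp: B_def)
      from add_subgroup_diff[OF C this] have "(u - v) - of_int p * (w - w') \<in> C j" by (simp add: algebra_simps)
      then show "u - v \<in> B j" by (auto simp: B_def)
    qed
    show "incseq B" using inc by (fastforce simp: B_def incseq_def)
    show "h * z \<in> B j" if z: "z \<in> B j" for j z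
    proof -
      obtain w where "z - of_int p * w \<in> C j" using z by (auto simp: B_def)
      from Ch[OF this] have "h * z - of_int p * (h * w) \<in> C j" by (simp add: algebra_simps)
      then show ?thesis by (auto simp: B_def)
    qed
    show "of_int p * z \<in> B j" for j z
      unfolding B_def using add_subgroup_zero[OF C] by (auto intro!: exI[of _ z])
  qed
  then obtain j2 where j2: "\<And>i. B i \<subseteq> B j2" by blast
  define j where "j = max j1 j2"
  have sub: "C j1 \<subseteq> C j" "C j2 \<subseteq> C j" using inc by (auto simp: j_def incseq_def)
  have "C i \<subseteq> C j" for i
  proof
    fix z assume z: "z \<in> C i"
    then have "z \<in> B i" by (auto simp: B_def intro!: exI[of _ 0])
    then obtain w where w: "z - of_int p * w \<in> C j2" using j2 by (auto simp: B_def)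
    have "z \<in> C (max i j)" "z - of_int p * w \<in> C (max i j)"
      using z w sub inc by (auto intro: incseq_maxI1 incseq_maxI2)
    then have "z - (z - of_int p * w) \<in> C (max i j)" using add_subgroup_diff[OF C] by blast
    then have "w \<in> D (max i j)" by (simp add: D_def)
    then have "of_int p * w \<in> C j1" using j1 by (auto simp: D_def)
    then show "z \<in> C j" using w sub add_subgroup_add[OF C] by (metis diff_add_cancel subsetD)
  qed
  then show ?case by blast
qed

lemma noeth_prime_power:
  fixes h :: "int poly"
  assumes "prime p" "i0 > 0" "\<not> p dvd coeff h i0" "h \<in> R"
  shows "noeth R (range ((*) (of_int (p ^ m))))"
  unfolding noeth_def
proof (intro allI impI, elim conjE)
  fix C :: "nat \<Rightarrow> int poly set"
  assume C: "\<forall>j. submod R (C j)" and inc: "incseq C" and N: "\<forall>j. range ((*) (of_int (p ^ m))) \<subseteq> C j"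
  have "\<exists>j. \<forall>i. C i \<subseteq> C j"
    using assms C inc N by (intro chain_mod_prime_power[of p i0 h C m]) (auto simp: submod_def image_subset_iff)
  then show "\<exists>j. C (Suc j) \<subseteq> C j" by blast
qed

section \<open>Profinitely closed subgroups of the polynomial ring\<close>

text \<open>The integers n with n b \<in> A form an ideal that no prime contains, hence the unit
  ideal. If a prime p divided its least positive element n, a multiplier prime to p would leave a
  smaller positive residue modulo n.\<close>

lemma mem_if_coprime_multiples:
  fixes b :: "'a::comm_ring_1"
  assumes A: "add_subgroup A" and loc: "\<And>p::int. prime p \<Longrightarrow> \<exists>n. coprime n p \<and> of_int n * b \<in> A"
  shows "b \<in> A"
proof -
  define Q where "Q n \<longleftrightarrow> n > 0 \<and> of_int (int n) * b \<in> A" for n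
  have ex: "\<exists>n. Q n"
  proof -
    \<comment> \<open>Any prime would do here; a multiplier prime to 2 is nonzero.\<close>
    obtain n :: int where n: "coprime n 2" "of_int n * b \<in> A" using loc[of 2] by auto
    then have "n \<noteq> 0" by auto
    moreover have "of_int \<bar>n\<bar> * b \<in> A" using n(2) add_subgroup_uminus[OF A n(2)] by (auto simp: abs_if)
    ultimately have "Q (nat \<bar>n\<bar>)" by (simp add: Q_def)
    then show ?thesis by blast
  qed
  define n where "n = (LEAST n. Q n)"
  have n: "n > 0" "of_int (int n) * b \<in> A" using LeastI_ex[OF ex] by (auto simp: n_def Q_def)
  have "n = 1"
  proof (rule ccontr)
    assume "n \<noteq> 1"
    then obtain p where p: "prime p" "p dvd n" using prime_factor_nat by blast
    then obtain m where m: "coprime m (int p)" "of_int m * b \<in> A" using loc[of "int p"] by auto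
    define r where "r = m mod int n"
    have "r = m - m div int n * int n" by (simp add: r_def minus_div_mult_eq_mod)
    then have "of_int r * b = of_int m * b - of_int (m div int n) * (of_int (int n) * b)"
      by (simp only: of_int_diff of_int_mult left_diff_distrib mult.assoc)
    then have "of_int r * b \<in> A"
      using add_subgroup_diff[OF A m(2) add_subgroup_of_int[OF A n(2)]] by metis
    moreover have "r \<noteq> 0"
    proof
      assume "r = 0"
      then have "int n dvd m" by (auto simp: r_def)
      then have "int p dvd m" using p(2) by (meson dvd_trans int_dvd_int_iff)
      then have "is_unit (int p)" by (rule coprime_common_divisor[OF m(1) _ dvd_refl])
      then show False using p(1) by (auto dest: prime_gt_1_nat)
    qed
    moreover have "r \<ge> 0" "r < int n" using n(1) by (auto simp: r_def)
    ultimately have "Q (nat r)" by (auto simp: Q_def)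
    then have "n \<le> nat r" unfolding n_def by (rule Least_le)
    then show False using \<open>r < int n\<close> \<open>r \<ge> 0\<close> by linarith
  qed
  then show ?thesis using n by simp
qed

text \<open>The scalar k has to be carried along: the chain condition over the integers holds above
  f P, and it is k f P that lies in A. Krull's theorem for p gives (1 - p c) k b \<in> A. If p
  divides k, this p is cancelled by \<open>krull_intersection_torsion\<close>, and squarefreeness
  makes the rest of k prime to p.\<close>

lemma padic_closed:
  fixes A :: "int poly set"
  assumes A: "add_subgroup A" and f: "lead_coeff f = 1" and k: "k > 0" "squarefree k"
    and kf: "\<And>z. of_int k * f * z \<in> A" and p: "prime p"
    and b: "\<And>m. \<exists>w\<in>A. \<exists>z. b = w + of_int (p ^ m) * z"
  shows "\<exists>n. coprime n p \<and> of_int n * b \<in> A"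
proof -
  define R :: "int poly set" where "R = range of_int"
  have noeth: "noeth R (range ((*) f))" unfolding R_def by (rule noeth_int[OF f])
  have R0: "1 \<in> R" unfolding R_def by (metis of_int_1 rangeI)
  have R1: "of_int c \<in> R" for c unfolding R_def by blast
  have R2: "u * v \<in> R" if "u \<in> R" "v \<in> R" for u v using that unfolding R_def by (auto simp flip: of_int_mult)
  have R3: "add_subgroup R" unfolding add_subgroup_def R_def
    by (auto simp flip: of_int_diff intro: range_eqI[of _ _ 0])
  have W: "submod R A" unfolding submod_def R_def using A add_subgroup_of_int by auto
  have "\<exists>\<rho>\<in>R. (1 - of_int p * \<rho>) * (of_int k * b) \<in> A"
  proof (rule krull_intersection[OF noeth R0 R2 R3 R1 W])
    show "of_int k * z \<in> A" if "z \<in> range ((*) f)" for z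
      using that kf by (auto simp: mult.assoc)
    show "\<exists>w\<in>A. \<exists>z. of_int k * b = w + of_int k * of_int p ^ j * z" for j
    proof -
      obtain w z where "w \<in> A" "b = w + of_int (p ^ j) * z" using b by blast
      then show ?thesis
        by (intro bexI[of _ "of_int k * w"] exI[of _ z]) (simp_all add: distrib_left mult.assoc add_subgroup_of_int A)
    qed
  qed
  then obtain c where c: "(1 - of_int p * of_int c) * (of_int k * b) \<in> A" by (auto simp: R_def)
  define n1 where "n1 = 1 - p * c"
  have n1b: "of_int (n1 * k) * b \<in> A" using c by (simp add: n1_def mult.assoc)
  have cop1: "coprime n1 p"
  proof (rule coprimeI)
    fix d assume "d dvd n1" "d dvd p"
    then have "d dvd n1 + p * c" by (intro dvd_add) auto
    then show "is_unit d" by (simp add: n1_def)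
  qed
  show ?thesis
  proof (cases "p dvd k")
    case False
    then have "coprime k p" using prime_imp_coprime[OF p] coprime_commute by blast
    then show ?thesis using n1b cop1 by (intro exI[of _ "n1 * k"]) auto
  next
    case True
    then obtain k' where k': "k = p * k'" by (rule dvdE)
    have "\<not> p dvd k'"
    proof
      assume "p dvd k'"
      then have "p ^ 2 dvd k" unfolding k' power2_eq_square by (intro mult_dvd_mono) auto
      then show False using k(2) p squarefreeD not_prime_unit by blast
    qed
    then have "coprime k' p" using prime_imp_coprime[OF p] coprime_commute by blast
    then have cop: "coprime (n1 * k') p" using cop1 by auto
    have "of_int (n1 * k') * b \<in> A"
    proof (rule krull_intersection_torsion[OF noeth W R1 R1])
      show "of_int (n1 * k') * of_int p * z \<in> A" if z: "z \<in> range ((*) f)" for z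
      proof -
        obtain y where "z = f * y" using z by auto
        then have "of_int (n1 * k') * of_int p * z = of_int n1 * (of_int k * f * y)"
          by (simp add: k' algebra_simps)
        then show ?thesis using add_subgroup_of_int[OF A kf] by metis
      qed
      show "of_int (n1 * k') * of_int p * b \<in> A" using n1b by (simp add: k' algebra_simps)
      show "\<exists>w\<in>A. \<exists>z. b = w + of_int p ^ j * z" for j using b[of j] by simp
    qed
    then show ?thesis using cop by blast
  qed
qed

lemma prime_not_dvd_power:
  fixes h :: "int poly"
  assumes "prime p" "\<not> of_int p dvd h"
  shows "\<not> of_int p dvd h ^ n"
proof -
  have "prime_elem [:p:]" using assms(1) by (intro lift_prime_elem_poly) auto
  then show ?thesis using assms(2) prime_elem_dvd_power by (auto simp: of_int_poly)
qed

text \<open>Apply Krull's theorem first to \<open>h\<close> and then to a multiplier \<open>r = 1 - h \<rho>\<close> with \<open>r b \<in> W\<close>.\<close>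
lemma adic_closed:
  fixes W :: "int poly set"
  assumes W: "add_subgroup W" and p: "prime p" and Wp: "\<And>z. of_int (p ^ m) * z \<in> W"
    and h: "coeff h 0 = 0" "\<not> of_int p dvd h" and Wh: "\<And>w. w \<in> W \<Longrightarrow> h * w \<in> W"
    and b: "\<And>g. \<not> of_int p dvd g \<Longrightarrow> \<exists>v. b - g * v \<in> W"
  shows "b \<in> W"
proof -
  \<comment> \<open>The largest ring over which W is a module; it contains h.\<close>
  define R where "R = {\<rho>. \<forall>w\<in>W. \<rho> * w \<in> W}"
  have R1: "1 \<in> R" "h \<in> R" using Wh by (auto simp: R_def)
  have R2: "u * v \<in> R" if "u \<in> R" "v \<in> R" for u v using that by (auto simp: R_def mult.assoc)
  have R3: "add_subgroup R" using W unfolding add_subgroup_def R_def by (auto simp: left_diff_distrib)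
  have WR: "submod R W" using W by (auto simp: submod_def R_def)
  \<comment> \<open>As h(0) = 0, a coefficient of h that is nonzero modulo p sits at a positive
    exponent, as the chain condition requires.\<close>
  obtain i0 where i0: "\<not> p dvd coeff h i0" using h by (auto simp: of_int_poly_dvd_iff)
  then have "i0 > 0" using h(1) by (cases i0) auto
  then have noeth: "noeth R (range ((*) (of_int (p ^ m))))"
    using noeth_prime_power[OF p _ i0 R1(2)] by blast
  have b': "\<exists>w\<in>W. \<exists>z. b = w + g ^ j * z" if g: "\<not> of_int p dvd g" for g j
  proof -
    obtain v where "b - g ^ j * v \<in> W" using b prime_not_dvd_power[OF p g] by blast
    then show ?thesis by (intro bexI[of _ "b - g ^ j * v"] exI[of _ v]) auto
  qed
  have "\<exists>\<rho>\<in>R. (1 - h * \<rho>) * (1 * b) \<in> W"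
    by (rule krull_intersection[OF noeth R1(1) R2 R3 R1(2) WR]) (use Wp b'[OF h(2)] in auto)
  then obtain \<rho> where \<rho>: "\<rho> \<in> R" "(1 - h * \<rho>) * b \<in> W" by auto
  define r where "r = 1 - h * \<rho>"
  have "r \<in> R" unfolding r_def using R1 R2 R3 \<rho>(1) add_subgroup_diff by blast
  \<comment> \<open>Again h(0) = 0 matters: r(0) = 1, so p does not divide r and b lies in W + r^j P
    for all j.\<close>
  have "coeff r 0 = 1" using h(1) by (simp add: r_def coeff_mult)
  then have r: "\<not> of_int p dvd r" using p by (metis of_int_poly_dvd_iff not_prime_unit)
  have "1 * b \<in> W"
  proof (rule krull_intersection_torsion[OF noeth WR \<open>r \<in> R\<close> R1(1)])
    show "1 * r * z \<in> W" if "z \<in> range ((*) (of_int (p ^ m)))" for z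
      using that submod_mult[OF WR \<open>r \<in> R\<close>] Wp by auto
  qed (use b'[OF r] \<rho>(2) in \<open>auto simp: r_def\<close>)
  then show ?thesis by simp
qed

text \<open>The ideals (p^m, h) with h nonzero modulo p suffice as test ideals, because they are
  what \<open>adic_closed\<close> consumes for the subgroup A + p^m P.\<close>

lemma separable_poly:
  fixes A :: "int poly set"
  assumes A: "add_subgroup A" and Amult: "\<And>u v. u \<in> A \<Longrightarrow> v \<in> A \<Longrightarrow> [:0, 1:] * u * v \<in> A"
    and k: "k > 0" "squarefree k" and f: "lead_coeff f = 1" and kf: "\<And>z. of_int k * f * z \<in> A"
    and b: "\<And>p m h. prime p \<Longrightarrow> \<not> of_int p dvd h \<Longrightarrow> \<exists>u v. b - of_int (p ^ m) * u - h * v \<in> A"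
  shows "b \<in> A"
proof (rule mem_if_coprime_multiples[OF A], rule ccontr)
  fix p :: int assume p: "prime p" and no: "\<nexists>n. coprime n p \<and> of_int n * b \<in> A"
  then obtain m where m: "\<not> (\<exists>w\<in>A. \<exists>z. b = w + of_int (p ^ m) * z)"
    using padic_closed[OF A f k kf p, of b] by blast
  \<comment> \<open>This is for the second case below, where p has to divide p^m.\<close>
  have "m > 0" 
  proof (rule ccontr)
    assume "\<not> m > 0"
    then have "b = 0 + of_int (p ^ m) * b" by simp
    then show False using m add_subgroup_zero[OF A] by blast
  qed
  define W where "W = {z. \<exists>u. z - of_int (p ^ m) * u \<in> A}"
  have AW: "A \<subseteq> W" by (auto simp: W_def intro!: exI[of _ 0])
  have Wp: "of_int (p ^ m) * z \<in> W" for z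
    using add_subgroup_zero[OF A] by (auto simp: W_def intro!: exI[of _ z])
  have W: "add_subgroup W"
    unfolding add_subgroup_def
  proof (intro conjI ballI)
    show "0 \<in> W" using AW add_subgroup_zero[OF A] by blast
    fix u v assume "u \<in> W" "v \<in> W"
    then obtain u' v' where "u - of_int (p ^ m) * u' \<in> A" "v - of_int (p ^ m) * v' \<in> A" by (auto simp: W_def)
    from add_subgroup_diff[OF A this] have "(u - v) - of_int (p ^ m) * (u' - v') \<in> A" by (simp add: algebra_simps)
    then show "u - v \<in> W" unfolding W_def by blast
  qed
  have "\<exists>h. coeff h 0 = 0 \<and> \<not> of_int p dvd h \<and> (\<forall>w\<in>W. h * w \<in> W)"
  proof (cases "\<exists>g\<in>A. \<not> of_int p dvd g")
    case True
    then obtain g where g: "g \<in> A" "\<not> of_int p dvd g" by blast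
    have "[:0, 1:] * g * w \<in> W" if w: "w \<in> W" for w
    proof -
      obtain u where u: "w - of_int (p ^ m) * u \<in> A" using w by (auto simp: W_def)
      have "[:0, 1:] * g * w - of_int (p ^ m) * ([:0, 1:] * g * u) \<in> A"
        using Amult[OF g(1) u] by (simp only: algebra_simps)
      then show ?thesis unfolding W_def by blast
    qed
    moreover have "\<not> of_int p dvd [:0, 1:] * g"
      using g(2) by (auto simp: of_int_poly_dvd_iff coeff_pCons split: nat.splits)
    ultimately show ?thesis by (intro exI[of _ "[:0, 1:] * g"]) (auto simp: mult.assoc)
  next
    case False
    \<comment> \<open>The leading coefficient of k f \<in> A \<subseteq> p P is k.\<close>
    have pkf: "p dvd k"
    proof -
      have "of_int p dvd of_int k * f * 1" using False kf by blast
      then show ?thesis using f of_int_poly_dvd_iff coeff_of_int_mult by (metis mult.right_neutral)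
    qed
    then obtain k' where k': "k = p * k'" by (rule dvdE)
    have "\<not> p dvd k'"
    proof
      assume "p dvd k'"
      then have "p ^ 2 dvd k" unfolding k' power2_eq_square by (intro mult_dvd_mono) auto
      then show False using k(2) p squarefreeD not_prime_unit by blast
    qed
    then have "coprime k' p" using prime_imp_coprime[OF p] coprime_commute by blast
    then have "coprime k' (p ^ m)" by simp
    then obtain s t where st: "s * k' + t * p ^ m = 1" using coprime_iff_gcd_eq_1 bezout_int by metis
    \<comment> \<open>Since k = p k' with k' invertible modulo p^m, all of p f P lies in W = A + p^m
      P.\<close>
    have pf: "of_int p * f * z \<in> W" for z
    proof -
      have "of_int p * f * z = of_int (s * k' + t * p ^ m) * (of_int p * f * z)" unfolding st by simp
      also have "\<dots> = of_int s * (of_int k * f * z) + of_int (p ^ m) * (of_int t * of_int p * f * z)"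
        by (simp add: k' algebra_simps)
      finally show ?thesis
        using add_subgroup_add[OF W _ Wp] AW add_subgroup_of_int[OF A kf] by (metis subsetD)
    qed
    have "[:0, 1:] * f * w \<in> W" if w: "w \<in> W" for w
    proof -
      obtain u where u: "w - of_int (p ^ m) * u \<in> A" using w by (auto simp: W_def)
      \<comment> \<open>Every w \<in> W is divisible by p, so x f w lies in p f P.\<close>
      have "of_int p dvd (of_int (p ^ m) :: int poly)" using \<open>m > 0\<close> by (simp add: dvd_power)
      then have "of_int p dvd of_int (p ^ m) * u" by (rule dvd_mult2)
      moreover have "of_int p dvd w - of_int (p ^ m) * u" using u False by blast
      ultimately have "of_int p dvd w - of_int (p ^ m) * u + of_int (p ^ m) * u" by (intro dvd_add)
      then have "of_int p dvd w" by simp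
      then obtain y where "w = of_int p * y" by (rule dvdE)
      then have "[:0, 1:] * f * w = of_int p * f * ([:0, 1:] * y)" by (simp only: algebra_simps)
      then show ?thesis using pf by metis
    qed
    moreover have "\<not> of_int p dvd [:0, 1:] * f"
    proof
      assume "of_int p dvd [:0, 1:] * f"
      then have "p dvd coeff ([:0, 1:] * f) (Suc (degree f))" using of_int_poly_dvd_iff by blast
      then show False using f p by (simp add: not_prime_unit)
    qed
    ultimately show ?thesis by (intro exI[of _ "[:0, 1:] * f"]) (auto simp: mult.assoc)
  qed
  then obtain h where h: "coeff h 0 = 0" "\<not> of_int p dvd h" "\<And>w. w \<in> W \<Longrightarrow> h * w \<in> W" by blast
  have "b \<in> W"
  proof (rule adic_closed[OF W p Wp h])
    fix g :: "int poly" assume "\<not> of_int p dvd g"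
    then obtain u v where "b - of_int (p ^ m) * u - g * v \<in> A" using b p by blast
    then have "b - g * v \<in> W" unfolding W_def by (auto intro!: exI[of _ u] simp: algebra_simps)
    then show "\<exists>v. b - g * v \<in> W" by blast
  qed
  then obtain u where "b - of_int (p ^ m) * u \<in> A" by (auto simp: W_def)
  then show False using m by (metis diff_add_cancel)
qed

section \<open>Finite index of the ideals (p^m, h)\<close>

definition finite_index :: "'a::ab_group_add set \<Rightarrow> bool" where
  "finite_index J \<longleftrightarrow> (\<exists>F. finite F \<and> (\<forall>z. \<exists>u\<in>F. z - u \<in> J))"

lemma finite_bounded_polys:
  "finite {g :: int poly. (\<forall>i. coeff g i \<in> {0..<c}) \<and> (\<forall>i\<ge>d. coeff g i = 0)}" (is "finite ?S")
proof (rule finite_subset)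
  show "finite (Poly ` {xs. set xs \<subseteq> {0..<c} \<and> length xs = d})"
    by (intro finite_imageI finite_lists_length_eq) auto
  show "?S \<subseteq> Poly ` {xs. set xs \<subseteq> {0..<c} \<and> length xs = d}"
  proof
    fix g assume g: "g \<in> ?S"
    have "g = Poly (map (coeff g) [0..<d])"
      using g by (auto simp: poly_eq_iff coeff_Poly_eq nth_default_def)
    then show "g \<in> Poly ` {xs. set xs \<subseteq> {0..<c} \<and> length xs = d}"
      using g by (intro image_eqI[of _ _ "map (coeff g) [0..<d]"]) auto
  qed
qed

lemma poly_reduce_mod:
  fixes g :: "int poly"
  assumes "c > 0"
  obtains u w where "g = u + of_int c * w" "\<And>i. coeff u i = coeff g i mod c"
proof -
  define u where "u = map_poly (\<lambda>x. x mod c) g"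
  have u: "coeff u i = coeff g i mod c" for i by (simp add: u_def coeff_map_poly)
  then have "of_int c dvd g - u" by (simp add: of_int_poly_dvd_iff mod_eq_dvd_iff[symmetric])
  then obtain w where "g - u = of_int c * w" by (rule dvdE)
  then show ?thesis using that u by (metis add_diff_cancel_left' diff_add_cancel add.commute)
qed

text \<open>Representatives are built digit by digit in base p: x + p y represents modulo (p^(m+1),
  h) if x runs through representatives modulo (p, h) and y through those modulo (p^m, h). The former
  are finite in number since modulo p the polynomial h may be replaced by a monic f.\<close>

lemma finite_index_prime_power:
  assumes p: "prime p" and h: "\<not> of_int p dvd h"
  shows "finite_index {of_int (p ^ m) * u + h * v | u v :: int poly. True}"
proof -
  obtain u w f where f: "of_int u * h = f + of_int p * w" "coprime u p" "lead_coeff f = 1"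
    using monic_mod_prime[OF p h] by metis
  define F where "F = {g :: int poly. (\<forall>i. coeff g i \<in> {0..<p}) \<and> (\<forall>i\<ge>degree f. coeff g i = 0)}"
  have finF: "finite F" unfolding F_def by (rule finite_bounded_polys)
  have F: "\<exists>y\<in>F. \<exists>s t. z = y + of_int p * s + h * t" for z
  proof -
    obtain q r where qr: "z = q * f + r" "\<And>i. degree f \<le> i \<Longrightarrow> coeff r i = 0"
      using monic_division[OF f(3)] by blast
    obtain y s where ys: "r = y + of_int p * s" "\<And>i. coeff y i = coeff r i mod p"
      using poly_reduce_mod[of p r] p prime_gt_0_int by blast
    have "y \<in> F" using qr(2) ys(2) prime_gt_0_int[OF p] by (auto simp: F_def)
    moreover have "z = y + of_int p * (s - q * w) + h * (of_int u * q)"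
    proof -
      have "z = q * (of_int u * h - of_int p * w) + (y + of_int p * s)" using qr(1) ys(1) f(1) by simp
      then show ?thesis by (simp add: algebra_simps)
    qed
    ultimately show ?thesis by blast
  qed
  have "\<exists>G. finite G \<and> (\<forall>z. \<exists>y\<in>G. \<exists>s t. z = y + of_int (p ^ m) * s + h * t)"
  proof (induction m)
    case 0
    have "z = 0 + of_int (p ^ 0) * z + h * 0" for z by simp
    then show ?case by (intro exI[of _ "{0}"]) blast
  next
    case (Suc m)
    then obtain G where G: "finite G" "\<And>z. \<exists>y\<in>G. \<exists>s t. z = y + of_int (p ^ m) * s + h * t" by blast
    define G' where "G' = (\<lambda>(x, y). x + of_int p * y) ` (F \<times> G)"
    have "\<exists>y\<in>G'. \<exists>s t. z = y + of_int (p ^ Suc m) * s + h * t" for z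
    proof -
      obtain x s t where x: "x \<in> F" "z = x + of_int p * s + h * t" using F by blast
      obtain y s' t' where y: "y \<in> G" "s = y + of_int (p ^ m) * s' + h * t'" using G(2) by blast
      have "x + of_int p * y \<in> G'" using x y by (auto simp: G'_def)
      moreover have "z = (x + of_int p * y) + of_int (p ^ Suc m) * s' + h * (t + of_int p * t')"
        using x(2) y(2) by (simp add: algebra_simps)
      ultimately show ?thesis by blast
    qed
    moreover have "finite G'" using finF G(1) by (simp add: G'_def)
    ultimately show ?case by blast
  qed
  then obtain G where G: "finite G" "\<And>z. \<exists>y\<in>G. \<exists>s t. z = y + of_int (p ^ m) * s + h * t" by blast
  show ?thesis unfolding finite_index_def
  proof (intro exI[of _ G] conjI allI G(1))
    fix z
    obtain y s t where "y \<in> G" "z = y + of_int (p ^ m) * s + h * t" using G(2) by blast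
    then show "\<exists>u\<in>G. z - u \<in> {of_int (p ^ m) * u + h * v | u v. True}"
      by (intro bexI[of _ y]) (auto simp: add.assoc simp del: of_int_power)
  qed
qed

section \<open>Evaluation at a ring element\<close>

lemma zsc_0 [simp]: "zsc 0 x = 0"
  and zsc_1 [simp]: "zsc 1 x = x"
  by (simp_all add: zsc_def)

lemma zsc_add_1: "zsc (k + 1) x = zsc k x + x"
proof -
  consider "k \<ge> 0" | "k = -1" | "k < -1" by linarith
  then show ?thesis
  proof cases
    case 1
    then have "nat (k + 1) = Suc (nat k)" by auto
    then show ?thesis using 1 by (simp add: zsc_def add.commute)
  next
    case 3
    then have "nat (- k) = Suc (nat (- (k + 1)))" by auto
    then show ?thesis using 3 by (simp add: zsc_def)
  qed (simp add: zsc_def)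
qed

lemma zsc_diff_1: "zsc (k - 1) x = zsc k x - x"
  using zsc_add_1[of "k - 1" x] by simp

lemma zsc_add_left: "zsc (k + l) x = zsc k x + zsc l x"
proof (induction l rule: int_induct[where k = 0])
  case (step1 i)
  have "zsc (k + (i + 1)) x = zsc ((k + i) + 1) x" by (simp add: add.assoc)
  then show ?case by (simp add: zsc_add_1 step1)
next
  case (step2 i)
  have "zsc (k + (i - 1)) x = zsc ((k + i) - 1) x" by (simp add: algebra_simps)
  then show ?case by (simp add: zsc_diff_1 step2)
qed simp

lemma zsc_add_right: "zsc k (x + y) = zsc k x + zsc k y"
  by (induction k rule: int_induct[where k = 0]) (simp_all add: zsc_add_1 zsc_diff_1)

lemma zsc_zero_right [simp]: "zsc k 0 = 0"
  by (induction k rule: int_induct[where k = 0]) (simp_all add: zsc_add_1 zsc_diff_1)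

lemma zsc_mult_left: "zsc k x * y = zsc k (x * y)"
  by (induction k rule: int_induct[where k = 0]) (simp_all add: zsc_add_1 zsc_diff_1 algebra_simps)

lemma zsc_mult_right: "x * zsc k y = zsc k (x * y)"
  by (induction k rule: int_induct[where k = 0]) (simp_all add: zsc_add_1 zsc_diff_1 algebra_simps)

lemma zsc_mult: "zsc (k * l) x = zsc k (zsc l x)"
  by (induction k rule: int_induct[where k = 0])
     (simp_all add: zsc_add_1 zsc_diff_1 distrib_right left_diff_distrib zsc_add_left,
      metis add_diff_cancel_right' diff_add_cancel zsc_add_left)

text \<open>\<open>meval a g\<close> is the value at \<open>a\<close> of \<open>x g(x)\<close>, so that all integer polynomials, not only those
  without constant term, parametrize \<open>zgen a\<close>.\<close>
definition meval :: "'a::ring \<Rightarrow> int poly \<Rightarrow> 'a" where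
  "meval a g = fold_coeffs (\<lambda>c y. zsc c a + a * y) g 0"

lemma meval_0 [simp]: "meval a 0 = 0"
  by (simp add: meval_def)

lemma meval_pCons [simp]: "meval a (pCons c g) = zsc c a + a * meval a g"
  by (cases "c = 0 \<and> g = 0") (auto simp: meval_def)

lemma meval_1: "meval a 1 = a"
  by (simp flip: pCons_one)

lemma meval_add: "meval a (g + h) = meval a g + meval a h"
proof (induction g arbitrary: h rule: pCons_induct)
  case (pCons c g)
  show ?case by (cases h) (simp add: pCons zsc_add_left distrib_left)
qed simp

lemma meval_diff: "meval a (g - h) = meval a g - meval a h"
  using meval_add[of a "g - h" h] by simp

lemma meval_smult: "meval a (smult c g) = zsc c (meval a g)"
  by (induction g rule: pCons_induct) (simp_all add: zsc_mult zsc_add_right zsc_mult_right)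

text \<open>Since (x g)(x h) = x (x g h), multiplication in the ring corresponds to (g, h) -> x g
  h.\<close>

lemma meval_mult: "meval a ([:0, 1:] * g * h) = meval a g * meval a h"
proof (induction g rule: pCons_induct)
  case (pCons c g)
  have "[:0, 1:] * pCons c g * h = pCons 0 (smult c h + [:0, 1:] * g * h)" by simp
  then have "meval a ([:0, 1:] * pCons c g * h) = a * (zsc c (meval a h) + meval a g * meval a h)"
    using pCons.IH by (simp add: meval_add meval_smult del: mult_pCons_left)
  then show ?case by (simp add: distrib_left distrib_right zsc_mult_left zsc_mult_right mult.assoc)
qed simp

lemma subring_of_range_meval: "subring_of (range (meval a))"
  unfolding subring_of_def
proof (intro conjI ballI)
  show "0 \<in> range (meval a)" by (rule range_eqI[of _ _ 0]) simp
qed (auto simp only: meval_add[symmetric] meval_diff[symmetric] meval_mult[symmetric])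

lemma subring_of_zsc:
  assumes "subring_of A" "x \<in> A"
  shows "zsc k x \<in> A"
  using assms
  by (induction k rule: int_induct[where k = 0]) (auto simp: subring_of_def zsc_add_1 zsc_diff_1)

lemma meval_in_subring:
  assumes "subring_of A" "a \<in> A"
  shows "meval a g \<in> A"
  using assms subring_of_zsc[OF assms]
  by (induction g rule: pCons_induct) (auto simp: subring_of_def)

lemma zgen_eq_range: "zgen a = range (meval a)"
proof
  show "zgen a \<subseteq> range (meval a)"
    unfolding zgen_def using subring_of_range_meval meval_1 by (metis (mono_tags, lifting) Inter_lower mem_Collect_eq rangeI)
  show "range (meval a) \<subseteq> zgen a"
    unfolding zgen_def using meval_in_subring by blast
qed

lemma meval_sum: "finite A \<Longrightarrow> meval a (\<Sum>i\<in>A. g i) = (\<Sum>i\<in>A. meval a (g i))"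
  by (induction A rule: finite_induct) (simp_all add: meval_add)

lemma meval_monom: "meval a (monom c n) = zsc c (apow a (Suc n))"
  by (induction n) (simp_all add: monom_0 monom_Suc zsc_mult_right)

lemma meval_monic_sum:
  assumes "n > 0"
  shows "apow a n + (\<Sum>i=1..n-1. zsc (ks i) (apow a (n - i)))
    = meval a (monom 1 (n - 1) + (\<Sum>i=1..n-1. monom (ks i) (n - 1 - i)))"
proof -
  have "(\<Sum>i=1..n-1. meval a (monom (ks i) (n - 1 - i))) = (\<Sum>i=1..n-1. zsc (ks i) (apow a (n - i)))"
    using assms by (intro sum.cong refl) (auto simp: meval_monom Suc_diff_Suc)
  then show ?thesis using assms by (simp add: meval_add meval_sum meval_monom)
qed

text \<open>The shift by x lowers degrees by one: an expression with leading term a^n comes from a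
  monic f of degree n - 1, and the constant coefficient of f belongs to the first power of
  a.\<close>

lemma meval_monic_iff:
  "(\<exists>n>0. \<exists>ks. zsc k (apow a n + (\<Sum>i=1..n-1. zsc (ks i) (apow a (n - i)))) = 0)
    \<longleftrightarrow> (\<exists>f. lead_coeff f = 1 \<and> meval a (of_int k * f) = 0)"
proof (intro iffI; elim exE conjE)
  fix n :: nat and ks assume n: "n > 0"
    and eq: "zsc k (apow a n + (\<Sum>i=1..n-1. zsc (ks i) (apow a (n - i)))) = 0"
  define f where "f = monom 1 (n - 1) + (\<Sum>i=1..n-1. monom (ks i) (n - 1 - i))"
  have cf: "coeff f m = (if m = n - 1 then 1 else 0)" if "m \<ge> n - 1" for m
    using that by (auto simp: f_def coeff_sum intro!: sum.neutral)
  have "degree f = n - 1"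
    by (rule antisym) (auto intro!: degree_le le_degree simp: cf)
  then have "lead_coeff f = 1" using cf by simp
  moreover have "meval a (of_int k * f) = 0"
    using eq unfolding meval_monic_sum[OF n] f_def[symmetric] by (simp add: of_int_poly meval_smult)
  ultimately show "\<exists>f. lead_coeff f = 1 \<and> meval a (of_int k * f) = 0" by blast
next
  fix f assume f: "lead_coeff f = 1" "meval a (of_int k * f) = 0"
  define n where "n = Suc (degree f)"
  define ks where "ks i = coeff f (degree f - i)" for i
  have "f = (\<Sum>i\<le>degree f. monom (coeff f i) i)" by (simp add: poly_as_sum_of_monoms)
  also have "\<dots> = (\<Sum>i\<le>degree f. monom (ks i) (degree f - i))"
    unfolding ks_def by (rule sum.reindex_bij_witness[of _ "\<lambda>i. degree f - i" "\<lambda>i. degree f - i"]) auto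
  also have "\<dots> = monom 1 (n - 1) + (\<Sum>i=1..n-1. monom (ks i) (n - 1 - i))"
    using f(1) by (simp add: atMost_atLeast0 sum.atLeast_Suc_atMost n_def ks_def)
  finally have fs: "f = monom 1 (n - 1) + (\<Sum>i=1..n-1. monom (ks i) (n - 1 - i))" .
  have "n > 0" by (simp add: n_def)
  have "zsc k (meval a f) = 0" using f(2) by (simp add: of_int_poly meval_smult)
  then have "zsc k (apow a n + (\<Sum>i=1..n-1. zsc (ks i) (apow a (n - i)))) = 0"
    unfolding meval_monic_sum[OF \<open>n > 0\<close>, of a ks] fs[symmetric] .
  then show "\<exists>n>0. \<exists>ks. zsc k (apow a n + (\<Sum>i=1..n-1. zsc (ks i) (apow a (n - i)))) = 0"
    using \<open>n > 0\<close> by blast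
qed

section \<open>Passage between finite quotients of P and of the ring\<close>

lemma submod_UNIV_poly:
  fixes J :: "int poly set"
  assumes J: "add_subgroup J" and x: "\<And>u. u \<in> J \<Longrightarrow> [:0, 1:] * u \<in> J"
  shows "submod UNIV J"
proof -
  have "v * u \<in> J" if u: "u \<in> J" for u v
  proof (induction v rule: pCons_induct)
    case 0
    then show ?case using J by (simp add: add_subgroup_zero)
  next
    case (pCons c v)
    have "pCons c v * u = of_int c * u + [:0, 1:] * (v * u)" by (simp add: of_int_poly)
    then show ?case using add_subgroup_add[OF J add_subgroup_of_int[OF J u] x[OF pCons.IH]] by metis
  qed
  then show ?thesis using J by (auto simp: submod_def)
qed

lemma submod_kernel_meval: "submod UNIV {g. meval a g = 0}"
  by (rule submod_UNIV_poly) (auto simp: add_subgroup_def meval_diff)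

lemma finite_ring_on_cancel:
  assumes "finite_ring_on C ad mu" "x \<in> C" "y \<in> C" "z \<in> C" "ad x z = ad y z"
  shows "x = y"
proof -
  note R = assms(1)[unfolded finite_ring_on_def]
  have assoc: "\<forall>x\<in>C. \<forall>y\<in>C. \<forall>z\<in>C. ad (ad x y) z = ad x (ad y z)"
    using R by (elim conjE)
  have comm: "\<forall>x\<in>C. \<forall>y\<in>C. ad x y = ad y x"
    using R by (elim conjE)
  have ex: "\<exists>e\<in>C. (\<forall>x\<in>C. ad e x = x) \<and> (\<forall>x\<in>C. \<exists>y\<in>C. ad x y = e)"
    using R by (elim conjE)
  obtain e where e: "e \<in> C" "\<And>x. x \<in> C \<Longrightarrow> ad e x = x" "\<And>x. x \<in> C \<Longrightarrow> \<exists>y\<in>C. ad x y = e"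
    using ex by blast
  obtain z' where z': "z' \<in> C" "ad z z' = e" using e(3) assms(4) by blast
  have "ad u e = u" if "u \<in> C" for u using comm e that by metis
  moreover have "ad (ad u z) z' = ad u e" if "u \<in> C" for u using assoc z' that assms(4) by metis
  ultimately show ?thesis using assms(2,3,5) by metis
qed

text \<open>A separating homomorphism is pulled back along \<open>meval a\<close>. As A contains the
  kernel, it is the full preimage of its image, so b stays outside; the fibre over zero is an ideal
  J of finite index.\<close>

lemma finitely_separable_poly:
  fixes A :: "int poly set"
  assumes sep: "finitely_separable (zgen a)"
    and A: "add_subgroup A" and ker: "\<And>g. meval a g = 0 \<Longrightarrow> g \<in> A"
    and mult: "\<And>u v. u \<in> A \<Longrightarrow> v \<in> A \<Longrightarrow> [:0, 1:] * u * v \<in> A" and b: "b \<notin> A"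
  shows "\<exists>J. submod UNIV J \<and> finite_index J \<and> (\<forall>u\<in>J. b - u \<notin> A)"
proof -
  have sub: "subring_of (meval a ` A)"
    unfolding subring_of_def
  proof (intro conjI ballI)
    show "0 \<in> meval a ` A" using add_subgroup_zero[OF A] by (intro image_eqI[of _ _ 0]) simp_all
  qed (use add_subgroup_add[OF A] add_subgroup_diff[OF A] mult in
      \<open>auto simp only: meval_add[symmetric] meval_diff[symmetric] meval_mult[symmetric]\<close>)
  have memA: "u \<in> A" if "meval a u = meval a v" "v \<in> A" for u v
    using add_subgroup_add[OF A ker[of "u - v"] that(2)] that(1) by (simp add: meval_diff)
  then have "meval a b \<notin> meval a ` A" using b by blast
  then obtain C ad mu \<phi> where C: "finite_ring_on C ad mu" and hom: "ring_hom_into (zgen a) \<phi> C ad mu"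
    and \<phi>: "\<phi> (meval a b) \<notin> \<phi> ` (meval a ` A)"
    using sep sub unfolding finitely_separable_def zgen_eq_range by (metis image_mono rangeI subset_UNIV)
  define \<psi> where "\<psi> g = \<phi> (meval a g)" for g
  have \<psi>C: "\<psi> g \<in> C" for g using hom by (auto simp: ring_hom_into_def zgen_eq_range \<psi>_def)
  have \<psi>_add: "\<psi> (g + h) = ad (\<psi> g) (\<psi> h)" for g h
    using hom by (auto simp: ring_hom_into_def zgen_eq_range \<psi>_def meval_add)
  have \<psi>_mult: "\<psi> ([:0, 1:] * g * h) = mu (\<psi> g) (\<psi> h)" for g h
    using hom unfolding \<psi>_def meval_mult by (auto simp: ring_hom_into_def zgen_eq_range)
  \<comment> \<open>The carrier C has no named zero; \<psi> 0 plays that part, and cancellation in C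
    makes J a subgroup.\<close>
  define J where "J = {g. \<psi> g = \<psi> 0}"
  have diff: "u - v \<in> J \<longleftrightarrow> \<psi> u = \<psi> v" for u v
  proof -
    have "\<psi> u = ad (\<psi> (u - v)) (\<psi> v)" "\<psi> v = ad (\<psi> 0) (\<psi> v)"
      using \<psi>_add[of "u - v" v] \<psi>_add[of 0 v] by simp_all
    then have "\<psi> u = \<psi> v \<longleftrightarrow> \<psi> (u - v) = \<psi> 0"
      using finite_ring_on_cancel[OF C \<psi>C[of "u - v"] \<psi>C[of 0] \<psi>C[of v]] by metis
    then show ?thesis by (simp add: J_def)
  qed
  have "add_subgroup J" unfolding add_subgroup_def using diff by (auto simp: J_def)
  moreover have "[:0, 1:] * u \<in> J" if "u \<in> J" for u
    using \<psi>_mult[of 1 u] \<psi>_mult[of 1 0] that by (simp add: J_def)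
  ultimately have "submod UNIV J" by (rule submod_UNIV_poly)
  moreover have "finite_index J"
    unfolding finite_index_def
  proof (intro exI[of _ "inv \<psi> ` range \<psi>"] conjI allI)
    have "finite (range \<psi>)" using \<psi>C C unfolding finite_ring_on_def by (intro finite_subset[of "range \<psi>" C]) auto
    then show "finite (inv \<psi> ` range \<psi>)" by simp
    show "\<exists>u\<in>inv \<psi> ` range \<psi>. z - u \<in> J" for z
      by (intro bexI[of _ "inv \<psi> (\<psi> z)"]) (auto simp: diff f_inv_into_f)
  qed
  moreover have "b - u \<notin> A" if "u \<in> J" for u
  proof
    assume "b - u \<in> A"
    moreover have "\<psi> b = \<psi> (b - u)" using that diff[of b "b - u"] by simp
    ultimately show False using \<phi> unfolding \<psi>_def by blast
  qed
  ultimately show ?thesis by blast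
qed

text \<open>Finite rings are represented on natural numbers, so the cosets of J are numbered by an
  injection \<theta>, and the operations are computed on representatives chosen by
  \<open>g\<close>.\<close>

lemma finite_quotient_hom:
  fixes J :: "'a::ring set"
  assumes S: "subring_of S" and J: "add_subgroup J" 
    and Jl: "\<And>x y. x \<in> S \<Longrightarrow> y \<in> J \<Longrightarrow> x * y \<in> J" and Jr: "\<And>x y. x \<in> S \<Longrightarrow> y \<in> J \<Longrightarrow> y * x \<in> J"
    and F: "finite F" "\<And>x. x \<in> S \<Longrightarrow> \<exists>u\<in>F. x - u \<in> J"
  shows "\<exists>C ad mu \<phi>. finite_ring_on C ad mu \<and> ring_hom_into S \<phi> C ad mu \<and>
    (\<forall>x\<in>S. \<forall>y\<in>S. \<phi> x = \<phi> y \<longrightarrow> x - y \<in> J)"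
proof -
  define cl where "cl x = {y. x - y \<in> J}" for x
  have cl: "cl x = cl y \<longleftrightarrow> x - y \<in> J" for x y
  proof
    assume "cl x = cl y"
    moreover have "y \<in> cl y" using J by (simp add: cl_def add_subgroup_zero)
    ultimately have "y \<in> cl x" by simp
    then show "x - y \<in> J" by (simp add: cl_def)
  next
    assume xy: "x - y \<in> J"
    have "x - z \<in> J \<longleftrightarrow> y - z \<in> J" for z
      using add_subgroup_add_iff[OF J xy, of "y - z"] by (simp add: algebra_simps)
    then show "cl x = cl y" by (simp add: cl_def)
  qed
  have "cl ` S \<subseteq> cl ` F" using F(2) cl by blast
  then have "finite (cl ` S)" using F(1) finite_subset by blast
  from finite_imp_inj_to_nat_seg[OF this] obtain \<theta> :: "'a set \<Rightarrow> nat" where \<theta>: "inj_on \<theta> (cl ` S)" by blast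
  define \<phi> where "\<phi> x = \<theta> (cl x)" for x
  have \<phi>: "\<phi> x = \<phi> y \<longleftrightarrow> x - y \<in> J" if "x \<in> S" "y \<in> S" for x y
    unfolding \<phi>_def cl[symmetric] using \<theta> that by (auto simp: inj_on_eq_iff)
  define g where "g = inv_into S \<phi>"
  define ad where "ad u v = \<phi> (g u + g v)" for u v
  define mu where "mu u v = \<phi> (g u * g v)" for u v
  have S_add: "x + y \<in> S" and S_diff: "x - y \<in> S" and S_mult: "x * y \<in> S"
    if "x \<in> S" "y \<in> S" for x y using S that by (auto simp: subring_of_def)
  have S0: "0 \<in> S" using S by (auto simp: subring_of_def)
  have gS: "g (\<phi> x) \<in> S" "g (\<phi> x) - x \<in> J" if "x \<in> S" for x
  proof -
    show *: "g (\<phi> x) \<in> S" unfolding g_def using that by (intro inv_into_into) auto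
    have "\<phi> (g (\<phi> x)) = \<phi> x" unfolding g_def using that by (intro f_inv_into_f) auto
    then show "g (\<phi> x) - x \<in> J" using \<phi>[OF * that] by simp
  qed
  have ad: "ad (\<phi> x) (\<phi> y) = \<phi> (x + y)" if "x \<in> S" "y \<in> S" for x y
  proof -
    have "(g (\<phi> x) - x) + (g (\<phi> y) - y) \<in> J" using add_subgroup_add[OF J] gS that by blast
    then have "(g (\<phi> x) + g (\<phi> y)) - (x + y) \<in> J" by (simp add: algebra_simps)
    then show ?thesis unfolding ad_def by (rule iffD2[OF \<phi>[OF S_add S_add], rotated -1]) (use gS that in auto)
  qed
  have mu: "mu (\<phi> x) (\<phi> y) = \<phi> (x * y)" if "x \<in> S" "y \<in> S" for x y
  proof -
    have "(g (\<phi> x) - x) * g (\<phi> y) \<in> J" "x * (g (\<phi> y) - y) \<in> J" using Jl Jr gS that by blast+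
    from add_subgroup_add[OF J this] have "g (\<phi> x) * g (\<phi> y) - x * y \<in> J" by (simp add: algebra_simps)
    then show ?thesis unfolding mu_def by (rule iffD2[OF \<phi>[OF S_mult S_mult], rotated -1]) (use gS that in auto)
  qed
  have "finite (\<phi> ` S)" unfolding \<phi>_def using \<open>finite (cl ` S)\<close> by (simp flip: image_image)
  then have "finite_ring_on (\<phi> ` S) ad mu"
    unfolding finite_ring_on_def
  proof (intro conjI)
    show "\<exists>e\<in>\<phi> ` S. (\<forall>x\<in>\<phi> ` S. ad e x = x) \<and> (\<forall>x\<in>\<phi> ` S. \<exists>y\<in>\<phi> ` S. ad x y = e)"
    proof (rule bexI[of _ "\<phi> 0"], intro conjI ballI)
      fix x assume "x \<in> \<phi> ` S"
      then obtain s where s: "s \<in> S" "x = \<phi> s" by blast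
      show "ad (\<phi> 0) x = x" using s S0 ad by simp
      have "0 - s \<in> S" using S_diff S0 s by blast
      then have "ad x (\<phi> (0 - s)) = \<phi> 0" using ad[of s "0 - s"] s by simp
      then show "\<exists>y\<in>\<phi> ` S. ad x y = \<phi> 0" using \<open>0 - s \<in> S\<close> by blast
    qed (use S0 in blast)
  qed (auto simp: ad mu S_add S_mult add_ac mult.assoc distrib_left distrib_right)
  moreover have "ring_hom_into S \<phi> (\<phi> ` S) ad mu"
    unfolding ring_hom_into_def using ad mu by auto
  ultimately show ?thesis using \<phi> by blast
qed

text \<open>The quotient of \<open>zgen a\<close> by the image of (p^m, h) is a finite ring, so if
  no finite ring separates b from A, then b lies in A plus that image. This is the hypothesis of
  \<open>separable_poly\<close> for the preimage of A.\<close>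

lemma finitely_separable_if:
  fixes a :: "'a::ring"
  assumes k: "k > 0" "squarefree k" and f: "lead_coeff f = 1" and kf: "meval a (of_int k * f) = 0"
  shows "finitely_separable (zgen a)"
  unfolding finitely_separable_def
proof (intro ballI allI impI, elim conjE, rule ccontr)
  fix b A
  assume b: "b \<in> zgen a" and A: "subring_of A" "A \<subseteq> zgen a" and bA: "b \<notin> A"
    and no: "\<nexists>C ad mu \<phi>. finite_ring_on C ad mu \<and> ring_hom_into (zgen a) \<phi> C ad mu \<and> \<phi> b \<notin> \<phi> ` A"
  obtain b' where b': "b = meval a b'" using b by (auto simp: zgen_eq_range)
  have "b' \<in> meval a -` A"
  proof (rule separable_poly[OF _ _ k f])
    show "[:0, 1:] * u * v \<in> meval a -` A"
      if "u \<in> meval a -` A" "v \<in> meval a -` A" for u v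
      using A(1) that unfolding vimage_def mem_Collect_eq meval_mult
      by (auto simp: subring_of_def)
    show "add_subgroup (meval a -` A)" using A(1) by (auto simp: add_subgroup_def subring_of_def meval_diff)
    show "of_int k * f * z \<in> meval a -` A" for z
      using submod_mult[OF submod_kernel_meval[of a], of z "of_int k * f"] kf A(1)
      by (simp add: mult.commute subring_of_def)
    fix p :: int and m h assume p: "prime p" and h: "\<not> of_int p dvd (h :: int poly)"
    define I where "I = {of_int (p ^ m) * u + h * v | u v. True}"
    have I: "submod UNIV I"
    proof (rule submod_UNIV_poly)
      show "add_subgroup I" unfolding add_subgroup_def
      proof (intro conjI ballI)
        show "0 \<in> I" unfolding I_def by (auto intro!: exI[of _ 0])
        fix s t assume "s \<in> I" "t \<in> I"
        then obtain u v u' v' where "s = of_int (p ^ m) * u + h * v" "t = of_int (p ^ m) * u' + h * v'"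
          unfolding I_def by blast
        then have "s - t = of_int (p ^ m) * (u - u') + h * (v - v')" by (simp add: algebra_simps)
        then show "s - t \<in> I" unfolding I_def by blast
      qed
      fix s assume "s \<in> I"
      then obtain u v where "s = of_int (p ^ m) * u + h * v" unfolding I_def by blast
      then have "[:0, 1:] * s = of_int (p ^ m) * ([:0, 1:] * u) + h * ([:0, 1:] * v)" by (simp only: algebra_simps)
      then show "[:0, 1:] * s \<in> I" unfolding I_def by blast
    qed
    obtain F where F: "finite F" "\<And>z. \<exists>u\<in>F. z - u \<in> I"
      using finite_index_prime_power[OF p h, of m] unfolding I_def finite_index_def by blast
    define J where "J = meval a ` I"
    have J: "add_subgroup J"
      using submod_add_subgroup[OF I] unfolding add_subgroup_def J_def
      by (auto simp flip: meval_diff intro: rev_image_eqI[of 0])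
    have Jmult: "x * y \<in> J" "y * x \<in> J" if xy: "x \<in> zgen a" "y \<in> J" for x y
    proof -
      obtain g i where gi: "x = meval a g" "y = meval a i" "i \<in> I" using xy unfolding zgen_eq_range J_def by blast
      have *: "[:0, 1:] * g * i \<in> I" using submod_mult[OF I _ gi(3)] by blast
      then have "[:0, 1:] * i * g \<in> I" by (simp only: mult_ac)
      with * show "x * y \<in> J" "y * x \<in> J" unfolding gi J_def meval_mult[symmetric] by (auto simp only: imageI)
    qed
    have fin: "\<exists>u\<in>meval a ` F. x - u \<in> J" if "x \<in> zgen a" for x
    proof -
      obtain g where g: "x = meval a g" using \<open>x \<in> zgen a\<close> by (auto simp: zgen_eq_range)
      obtain u where "u \<in> F" "g - u \<in> I" using F(2) by blast
      then show ?thesis unfolding g J_def by (auto simp flip: meval_diff)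
    qed
    obtain C ad mu \<phi> where \<phi>: "finite_ring_on C ad mu" "ring_hom_into (zgen a) \<phi> C ad mu"
      "\<And>x y. x \<in> zgen a \<Longrightarrow> y \<in> zgen a \<Longrightarrow> \<phi> x = \<phi> y \<Longrightarrow> x - y \<in> J"
      using finite_quotient_hom[OF subring_of_range_meval[of a, folded zgen_eq_range] J Jmult finite_imageI[OF F(1)] fin]
      by blast
    then obtain w where w: "w \<in> A" "\<phi> b = \<phi> w" using no by blast
    then have "b - w \<in> J" using \<phi>(3) b A(2) by blast
    then obtain u v where "b - w = meval a (of_int (p ^ m) * u + h * v)" by (auto simp: J_def I_def)
    then have "meval a (b' - of_int (p ^ m) * u - h * v) = w"
      unfolding b' by (simp add: meval_diff meval_add algebra_simps)
    then show "\<exists>u v. b' - of_int (p ^ m) * u - h * v \<in> meval a -` A" using w(1) by blast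
  qed
  then show False using bA b' by simp
qed

section \<open>Consequences of finite separability\<close>

lemma pigeonhole_seq:
  assumes "finite_index J"
  obtains i j :: nat and g where "N \<le> i" "i < j" "s i - g \<in> J" "s j - g \<in> J"
proof -
  obtain F where F: "finite F" "\<And>z. \<exists>u\<in>F. z - u \<in> J" using assms unfolding finite_index_def by blast
  then have "\<forall>i. \<exists>u. u \<in> F \<and> s i - u \<in> J" by blast
  then obtain g where g: "\<And>i. g i \<in> F" "\<And>i. s i - g i \<in> J" by metis
  have "\<not> inj_on g {N..}"
    using finite_imageD[of g "{N..}"] finite_subset[of "g ` {N..}" F] F(1) g(1) infinite_Ici by blast
  then obtain i j where "N \<le> i" "N \<le> j" "i \<noteq> j" "g i = g j" by (auto simp: inj_on_def)
  then show ?thesis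
    using that[of i j "g i"] that[of j i "g i"] g(2)[of i] g(2)[of j] by (cases "i < j") auto
qed

lemma finite_index_power_diff:
  fixes y :: "'a::comm_ring_1"
  assumes "submod UNIV J" "finite_index J"
  obtains s t where "t > 0" "y ^ s - y ^ (s + t) \<in> J"
proof -
  obtain i j g where ij: "i < j" "y ^ i - g \<in> J" "y ^ j - g \<in> J"
    using pigeonhole_seq[OF assms(2), of 0 "\<lambda>i. y ^ i"] by metis
  have "y ^ i - y ^ j \<in> J"
    using add_subgroup_diff[OF submod_add_subgroup[OF assms(1)] ij(2,3)] by simp
  then show ?thesis using that[of "j - i" i] ij(1) by simp
qed

text \<open>An additive functional whose values on the monomials x^m are not eventually periodic in
  m. The bound \<open>degree g\<close> loses no square exponent because i \<le> i^2.\<close>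

definition square_coeff_sum :: "int poly \<Rightarrow> int" where
  "square_coeff_sum g = (\<Sum>i\<le>degree g. coeff g (i ^ 2))"

lemma square_coeff_sum_eq:
  assumes "degree g \<le> n"
  shows "square_coeff_sum g = (\<Sum>i\<le>n. coeff g (i ^ 2))"
  unfolding square_coeff_sum_def
proof (rule sum.mono_neutral_left)
  show "\<forall>i\<in>{..n} - {..degree g}. coeff g (i ^ 2) = 0"
  proof
    fix i assume "i \<in> {..n} - {..degree g}"
    then have "degree g < i" by auto
    also have "i \<le> i ^ 2" by (simp add: power2_eq_square)
    finally show "coeff g (i ^ 2) = 0" by (rule coeff_eq_0)
  qed
qed (use assms in auto)

lemma square_coeff_sum_diff: "square_coeff_sum (g - h) = square_coeff_sum g - square_coeff_sum h"
proof -
  define n where "n = max (degree g) (degree h)"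
  have "degree (g - h) \<le> n" unfolding n_def by (rule degree_diff_le_max)
  then show ?thesis
    using square_coeff_sum_eq[of g n] square_coeff_sum_eq[of h n] square_coeff_sum_eq[of "g - h" n]
    by (simp add: n_def sum_subtractf)
qed

lemma square_coeff_sum_of_int_mult: "square_coeff_sum (of_int c * g) = c * square_coeff_sum g"
  using square_coeff_sum_eq[OF degree_of_int_mult_le[of c g]]
  by (simp add: square_coeff_sum_def sum_distrib_left)

lemma square_coeff_sum_monom: "square_coeff_sum (monom 1 m) = (if \<exists>i. m = i ^ 2 then 1 else 0)"
proof (cases "\<exists>i. m = i ^ 2")
  case True
  then obtain i where i: "m = i ^ 2" by blast
  have "i \<le> m" by (simp add: i power2_eq_square)
  have "square_coeff_sum (monom 1 m) = (\<Sum>j\<le>m. if j = i then 1 else 0)"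
    unfolding square_coeff_sum_def by (intro sum.cong) (auto simp: degree_monom_eq i)
  then show ?thesis using True \<open>i \<le> m\<close> by simp
next
  case False
  then have "coeff (monom (1::int) m) (i ^ 2) = 0" for i by auto
  then show ?thesis using False by (simp add: square_coeff_sum_def)
qed

text \<open>Gaps between consecutive squares outgrow any period \<open>t\<close>, so no finite quotient sees the
  condition that \<open>p\<close> divides \<open>square_coeff_sum g\<close>.\<close>
lemma monic_mod_prime_square:
  assumes sep: "finitely_separable (zgen a)" and p: "prime p"
  shows "\<exists>f g. lead_coeff f = 1 \<and> meval a (of_int p * f - of_int (p ^ 2) * g) = 0"
proof (rule ccontr)
  assume no: "\<not> ?thesis"
  define I where "I = {g. meval a g = 0}"
  have I: "submod UNIV I" unfolding I_def by (rule submod_kernel_meval)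
  note Ig = submod_add_subgroup[OF I]
  have Im: "v * u \<in> I" if "u \<in> I" for u v using submod_mult[OF I] that by blast
  \<comment> \<open>A lies between p^2 P + I and p P + I. It is closed under (u, v) -> x u v since x
    (p g) (p h) = p (p x g h), and the functional is divisible by p on multiples of p.\<close>
  define A where "A = {u. \<exists>g. p dvd square_coeff_sum g \<and> u - of_int p * g \<in> I}"
  have A: "add_subgroup A"
    unfolding add_subgroup_def
  proof (intro conjI ballI)
    have "p dvd square_coeff_sum 0" "0 - of_int p * 0 \<in> I"
      using add_subgroup_zero[OF Ig] by (simp_all add: square_coeff_sum_def)
    then show "0 \<in> A" unfolding A_def by blast
    fix u v assume "u \<in> A" "v \<in> A"
    then obtain g h where gh: "p dvd square_coeff_sum g" "p dvd square_coeff_sum h"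
      "u - of_int p * g \<in> I" "v - of_int p * h \<in> I" by (auto simp: A_def)
    have "p dvd square_coeff_sum (g - h)" using gh by (simp add: square_coeff_sum_diff)
    moreover have "(u - v) - of_int p * (g - h) \<in> I"
      using add_subgroup_diff[OF Ig gh(3,4)] by (simp add: algebra_simps)
    ultimately show "u - v \<in> A" unfolding A_def by blast
  qed
  have ker: "g \<in> A" if "meval a g = 0" for g
    unfolding A_def using that by (auto simp: I_def square_coeff_sum_def intro!: exI[of _ 0])
  have mult: "[:0, 1:] * u * v \<in> A" if "u \<in> A" "v \<in> A" for u v
  proof -
    obtain g h where gh: "u - of_int p * g \<in> I" "v - of_int p * h \<in> I" using \<open>u \<in> A\<close> \<open>v \<in> A\<close> by (auto simp: A_def)
    have "p dvd square_coeff_sum (of_int p * ([:0, 1:] * g * h))" by (simp only: square_coeff_sum_of_int_mult dvd_triv_left)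
    moreover have "[:0, 1:] * u * v - of_int p * (of_int p * ([:0, 1:] * g * h))
      = ([:0, 1:] * v) * (u - of_int p * g) + ([:0, 1:] * of_int p * g) * (v - of_int p * h)"
      by (simp only: algebra_simps)
    ultimately show ?thesis unfolding A_def using add_subgroup_add[OF Ig Im[OF gh(1)] Im[OF gh(2)]] by (metis (mono_tags, lifting) mem_Collect_eq)
  qed
  \<comment> \<open>Otherwise p (1 - g) \<in> I, where the functional of 1 - g is 1 modulo p because
    0 is a square exponent. Then p does not divide 1 - g, and scaling it to a monic polynomial
    modulo p gives the excluded relation.\<close>
  have "of_int p \<notin> A"
  proof
    assume "of_int p \<in> A"
    then obtain g where g: "p dvd square_coeff_sum g" "of_int p - of_int p * g \<in> I" by (auto simp: A_def)
    have "square_coeff_sum (1 - g) = 1 - square_coeff_sum g"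
      using square_coeff_sum_monom[of 0] by (simp add: square_coeff_sum_diff)
    moreover have "\<not> p dvd 1 - square_coeff_sum g"
    proof
      assume "p dvd 1 - square_coeff_sum g"
      then have "p dvd 1 - square_coeff_sum g + square_coeff_sum g" using g(1) by (rule dvd_add)
      then show False using p by (simp add: not_prime_unit)
    qed
    ultimately have "\<not> p dvd square_coeff_sum (1 - g)" by simp
    then have "\<not> of_int p dvd 1 - g" by (auto simp: square_coeff_sum_of_int_mult elim!: dvdE)
    then obtain u w f where f: "of_int u * (1 - g) = f + of_int p * w" "lead_coeff f = 1"
      using monic_mod_prime[OF p] by metis
    have "of_int u * (of_int p - of_int p * g) = of_int p * (of_int u * (1 - g))" by (simp add: algebra_simps)
    also have "\<dots> = of_int p * f - of_int (p ^ 2) * (- w)" unfolding f(1) by (simp add: algebra_simps power2_eq_square)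
    finally have "of_int p * f - of_int (p ^ 2) * (- w) \<in> I" using Im[OF g(2)] by metis
    then show False using no f(2) unfolding I_def by blast
  qed
  then obtain J where J: "submod UNIV J" "finite_index J" "\<And>u. u \<in> J \<Longrightarrow> of_int p - u \<notin> A"
    using finitely_separable_poly[OF sep A ker mult] by blast
  obtain r t where rt: "t > 0" "monom 1 1 ^ r - monom 1 1 ^ (r + t) \<in> J"
    using finite_index_power_diff[OF J(1,2)] by blast
  \<comment> \<open>The square after n^2 is n^2 + 2 n + 1, and n \<ge> t puts n^2 + t strictly
    between; n \<ge> r places both exponents in the periodic range.\<close>
  define n where "n = r + t"
  have "r \<le> n" by (simp add: n_def)
  also have "n \<le> n ^ 2" by (simp add: power2_eq_square)
  finally have "r \<le> n ^ 2" .
  \<comment> \<open>The functional is 1 on e, hence 0 on 1 - e, so p - p e = p (1 - e) lies in A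
    although p e \<in> J.\<close>
  define e where "e = monom 1 (n ^ 2) - monom (1::int) (n ^ 2 + t)"
  have "monom 1 (n ^ 2 - r) * (monom 1 1 ^ r - monom 1 1 ^ (r + t)) \<in> J"
    using submod_mult[OF J(1) UNIV_I rt(2)] .
  then have "e \<in> J" using \<open>r \<le> n ^ 2\<close> by (simp add: e_def right_diff_distrib mult_monom monom_power)
  then have peJ: "of_int p * e \<in> J" using submod_mult[OF J(1)] by blast
  have nsq: "\<not> (\<exists>i. n ^ 2 + t = i ^ 2)"
  proof
    assume "\<exists>i. n ^ 2 + t = i ^ 2"
    then obtain i where i: "n ^ 2 + t = i ^ 2" by blast
    then have "n ^ 2 < i ^ 2" using rt(1) by linarith
    then have "n < i" by (rule power_less_imp_less_base) simp
    then have "(n + 1) ^ 2 \<le> i ^ 2" by (intro power_mono) auto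
    moreover have "(n + 1) ^ 2 = n ^ 2 + 2 * n + 1" by (simp add: power2_eq_square)
    moreover have "t \<le> n" by (simp add: n_def)
    ultimately show False using i by linarith
  qed
  have "square_coeff_sum e = 1"
    using nsq by (auto simp: e_def square_coeff_sum_diff square_coeff_sum_monom)
  then have "square_coeff_sum (1 - e) = 0"
    using square_coeff_sum_monom[of 0] by (simp add: square_coeff_sum_diff)
  moreover have "(of_int p - of_int p * e) - of_int p * (1 - e) \<in> I"
    using add_subgroup_zero[OF Ig] by (simp add: algebra_simps)
  ultimately have "of_int p - of_int p * e \<in> A" unfolding A_def by (metis (mono_tags, lifting) dvd_0_right mem_Collect_eq)
  then show False using J(3)[OF peJ] by blast
qed

section \<open>From relations modulo squares to monic multiples in the kernel\<close>

lemma monic_mod_square: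
  fixes c :: int
  assumes sep: "finitely_separable (zgen a)" and "c > 0"
  shows "\<exists>f g. lead_coeff f = 1 \<and> meval a (of_int c * f - of_int (c ^ 2) * g) = 0"
  using \<open>c > 0\<close>
proof (induction "nat c" arbitrary: c rule: less_induct)
  case less
  note I = submod_kernel_meval[of a]
  show ?case
  proof (cases "c = 1")
    case True
    then show ?thesis by (intro exI[of _ 1]) auto
  next
    case False
    then obtain p where p: "prime p" "p dvd c" using prime_divisor_exists[of c] less.prems by auto
    then obtain d where d: "c = p * d" by (auto elim: dvdE)
    have "p > 1" using p(1) by (rule prime_gt_1_int)
    have "d > 0" using less.prems d \<open>p > 1\<close> by (simp add: zero_less_mult_iff)
    then have "d < c" using d \<open>p > 1\<close> by simp
    then obtain f g where fg: "lead_coeff f = 1" "meval a (of_int d * f - of_int (d ^ 2) * g) = 0"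
      using less.hyps[of d] \<open>d > 0\<close> by auto
    obtain f' g' where fg': "lead_coeff f' = 1" "meval a (of_int p * f' - of_int (p ^ 2) * g') = 0"
      using monic_mod_prime_square[OF sep p(1)] by blast
    \<comment> \<open>The relations d f = d^2 g and p f' = p^2 g' modulo the kernel are multiplied,
      giving d p f f' = (d p)^2 g g'.\<close>
    define w where "w = f' * (of_int p * (of_int d * f - of_int (d ^ 2) * g))
      + of_int (d ^ 2) * g * (of_int p * f' - of_int (p ^ 2) * g')"
    have "w \<in> {g. meval a g = 0}" unfolding w_def
      using submod_mult[OF I] fg(2) fg'(2) by (intro add_subgroup_add[OF submod_add_subgroup[OF I]]) blast+
    moreover have "w = of_int c * (f * f') - of_int (c ^ 2) * (g * g')"
      by (simp add: w_def d algebra_simps power2_eq_square)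
    ultimately have "meval a (of_int c * (f * f') - of_int (c ^ 2) * (g * g')) = 0" by simp
    moreover have "lead_coeff (f * f') = 1" using fg fg' by (simp add: lead_coeff_mult)
    ultimately show ?thesis by blast
  qed
qed

lemma ex_monic_multiple:
  assumes sep: "finitely_separable (zgen a)"
  shows "\<exists>m f. m > 0 \<and> lead_coeff f = 1 \<and> meval a (of_int m * f) = 0"
proof -
  define I where "I = {g. meval a g = 0}"
  have I: "submod UNIV I" unfolding I_def by (rule submod_kernel_meval)
  note Ig = submod_add_subgroup[OF I]
  have Im: "v * u \<in> I" if "u \<in> I" for u v using submod_mult[OF I] that by blast
  \<comment> \<open>The relation for the prime 2 yields a nonzero kernel element: at
    \<open>degree f\<close> its coefficient is 2 modulo 4.\<close>
  obtain h where h: "h \<in> I" "lead_coeff h > 0"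
  proof -
    obtain f g where fg: "lead_coeff f = 1" "meval a (of_int 2 * f - of_int (2 ^ 2) * g) = 0"
      using monic_mod_prime_square[OF sep, of 2] by auto
    define h where "h = of_int 2 * f - of_int (2 ^ 2) * g"
    have "coeff h (degree f) \<noteq> 0"
    proof
      assume "coeff h (degree f) = 0"
      then have "2 = 4 * coeff g (degree f)" using fg(1) by (simp only: h_def coeff_diff coeff_of_int_mult) simp
      then show False by presburger
    qed
    then have "lead_coeff h \<noteq> 0" by auto
    moreover have "h \<in> I" using fg(2) by (simp add: I_def h_def)
    moreover have "- h \<in> I" if "h \<in> I" using add_subgroup_uminus[OF Ig that] .
    ultimately show ?thesis using that[of h] that[of "- h"]
      by (cases "lead_coeff h" "0::int" rule: linorder_cases) auto
  qed
  define c n where "c = lead_coeff h" and "n = degree h"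
  have c: "c > 0" using h by (simp add: c_def)
  \<comment> \<open>X q = c q(c x), so \<open>meval a (X q)\<close> is the value of x q(x) at c a;
    the set A below corresponds to the subring generated by c a.\<close>
  define X where "X q = of_int c * pcompose q [:0, c:]" for q :: "int poly"
  have X_diff: "X (q - r) = X q - X r" for q r by (simp add: X_def pcompose_diff right_diff_distrib)
  have coeff_X: "coeff (X q) i = c ^ Suc i * coeff q i" for q i
    by (simp add: X_def coeff_pcompose_linear)
  define A where "A = {u. \<exists>q. u - X q \<in> I}"
  have XA: "X q \<in> A" for q unfolding A_def using add_subgroup_zero[OF Ig] by (auto intro!: exI[of _ q])
  have IA: "u \<in> A" if "u \<in> I" for u unfolding A_def using that by (auto intro!: exI[of _ 0] simp: X_def)
  have A: "add_subgroup A"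
    unfolding add_subgroup_def
  proof (intro conjI ballI)
    show "0 \<in> A" using IA add_subgroup_zero[OF Ig] by blast
    fix u v assume "u \<in> A" "v \<in> A"
    then obtain q r where qr: "u - X q \<in> I" "v - X r \<in> I" by (auto simp: A_def)
    have "(u - v) - X (q - r) \<in> I" using add_subgroup_diff[OF Ig qr] by (simp add: X_diff algebra_simps)
    then show "u - v \<in> A" unfolding A_def by blast
  qed
  have mult: "[:0, 1:] * u * v \<in> A" if uv: "u \<in> A" "v \<in> A" for u v
  proof -
    obtain q r where qr: "u - X q \<in> I" "v - X r \<in> I" using uv by (auto simp: A_def)
    have "X ([:0, 1:] * q * r) = [:0, 1:] * X q * X r"
      unfolding X_def pcompose_mult by (simp add: pcompose_pCons of_int_poly)
    then have "[:0, 1:] * u * v - X ([:0, 1:] * q * r) = ([:0, 1:] * v) * (u - X q) + ([:0, 1:] * X q) * (v - X r)"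
      by (simp only: algebra_simps)
    then have "[:0, 1:] * u * v - X ([:0, 1:] * q * r) \<in> I"
      using add_subgroup_add[OF Ig Im[OF qr(1)] Im[OF qr(2)]] by metis
    then show ?thesis unfolding A_def by blast
  qed
  \<comment> \<open>X scales the coefficient at i by c^(i+1), which divides c^N for i < N.\<close>
  have degA: "of_int (c ^ N) * z \<in> A" if "\<And>i. N \<le> i \<Longrightarrow> coeff z i = 0" for N z
  proof -
    define q where "q = (\<Sum>i<N. monom (c ^ (N - Suc i) * coeff z i) i)"
    have "coeff q i = (if i < N then c ^ (N - Suc i) * coeff z i else 0)" for i
      by (auto simp: q_def coeff_sum)
    then have "coeff (X q) i = c ^ N * coeff z i" for i
      using that[of i] by (auto simp: coeff_X simp flip: power_Suc power_add mult.assoc)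
    then have "X q = of_int (c ^ N) * z" by (simp add: poly_eq_iff del: of_int_power)
    then show ?thesis using XA[of q] by simp
  qed
  obtain f g where fg: "lead_coeff f = 1" "of_int c * f - of_int (c ^ 2) * g \<in> I"
    using monic_mod_square[OF sep c] unfolding I_def by blast
  define N where "N = Suc (degree f)"
  \<comment> \<open>Density: c^N P \<subseteq> A + c^(N+s) P. Divide w by f; the part q f gains a
    factor c from the relation c f = c^2 g modulo I, and the remainder is absorbed by
    \<open>degA\<close>.\<close>
  have step: "\<exists>w. of_int (c ^ N) * z - of_int (c ^ (N + s)) * w \<in> A" for z s
  proof (induction s)
    case 0
    show ?case using add_subgroup_zero[OF A] by (intro exI[of _ z]) simp
  next
    case (Suc s)
    then obtain w where w: "of_int (c ^ N) * z - of_int (c ^ (N + s)) * w \<in> A" by blast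
    obtain q r where qr: "w = q * f + r" "\<And>i. degree f \<le> i \<Longrightarrow> coeff r i = 0"
      using monic_division[OF fg(1)] by blast
    have "of_int (c ^ (degree f + s)) * q * (of_int c * f - of_int (c ^ 2) * g) \<in> A" by (rule IA[OF Im[OF fg(2)]])
    moreover have "of_int (c ^ (N + s)) * r \<in> A" by (rule degA) (use qr(2) in \<open>auto simp: N_def\<close>)
    ultimately have "(of_int (c ^ N) * z - of_int (c ^ (N + s)) * w) +
      (of_int (c ^ (degree f + s)) * q * (of_int c * f - of_int (c ^ 2) * g) + of_int (c ^ (N + s)) * r) \<in> A"
      using add_subgroup_add[OF A] w by blast
    also have "(of_int (c ^ N) * z - of_int (c ^ (N + s)) * w) +
      (of_int (c ^ (degree f + s)) * q * (of_int c * f - of_int (c ^ 2) * g) + of_int (c ^ (N + s)) * r)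
      = of_int (c ^ N) * z - of_int (c ^ (N + Suc s)) * (q * g)"
      unfolding qr(1) N_def by (simp add: algebra_simps power2_eq_square)
    finally show ?case by blast
  qed
  \<comment> \<open>Separability turns density into membership: modulo J the powers of c are
    periodic, so c^s may be replaced by c^(s + t i) with i beyond the degree of w, and c^(N + s + t
    i) w lies in A by \<open>degA\<close>.\<close>
  have full: "of_int (c ^ N) * z \<in> A" for z
  proof (rule ccontr)
    assume "of_int (c ^ N) * z \<notin> A"
    then obtain J where J: "submod UNIV J" "finite_index J" "\<And>u. u \<in> J \<Longrightarrow> of_int (c ^ N) * z - u \<notin> A"
      using finitely_separable_poly[OF sep A IA[unfolded I_def, OF CollectI] mult] by blast
    note Jg = submod_add_subgroup[OF J(1)]
    obtain s t where st: "t > 0" "(of_int c) ^ s - (of_int c) ^ (s + t) \<in> J"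
      using finite_index_power_diff[OF J(1,2), of "of_int c"] by blast
    have per: "(of_int c) ^ s - (of_int c) ^ (s + t * i) \<in> J" for i
    proof (induction i)
      case 0
      show ?case using add_subgroup_zero[OF Jg] by simp
    next
      case (Suc i)
      have "of_int c ^ (t * i) * ((of_int c) ^ s - (of_int c) ^ (s + t)) \<in> J"
        using submod_mult[OF J(1) UNIV_I st(2)] .
      from add_subgroup_add[OF Jg Suc this] show ?case by (simp add: algebra_simps power_add)
    qed
    obtain w where w: "of_int (c ^ N) * z - of_int (c ^ (N + s)) * w \<in> A" using step by blast
    define i where "i = Suc (degree w)"
    have "i \<le> t * i" using st(1) by simp
    then have "of_int (c ^ (N + (s + t * i))) * w \<in> A"
      by (intro degA) (auto intro!: coeff_eq_0 simp: i_def)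
    from add_subgroup_add[OF A w this]
    have "of_int (c ^ N) * z - of_int (c ^ N) * w * ((of_int c) ^ s - (of_int c) ^ (s + t * i)) \<in> A"
      by (simp add: algebra_simps power_add)
    then show False using J(3) submod_mult[OF J(1) UNIV_I per] by blast
  qed
  \<comment> \<open>Here c^n h = X G with G monic of degree n. So c a satisfies a monic equation,
    and q can be reduced modulo G to degree below n.\<close>
  have "\<exists>q. (\<forall>i\<ge>n. coeff q i = 0) \<and> u - X q \<in> I" if u: "u \<in> A" for u
  proof -
    obtain q where q: "u - X q \<in> I" using u by (auto simp: A_def)
    define G where "G = monom 1 n + (\<Sum>i<n. monom (c ^ (n - Suc i) * coeff h i) i)"
    have cG: "coeff G i = (if i < n then c ^ (n - Suc i) * coeff h i else if i = n then 1 else 0)" for i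
      by (auto simp: G_def coeff_sum)
    have "degree G = n" by (rule antisym) (auto intro!: degree_le le_degree simp: cG)
    then have G: "lead_coeff G = 1" by (simp add: cG)
    have "coeff (X G) i = c ^ n * coeff h i" for i
    proof -
      consider "i < n" | "i = n" | "i > n" by linarith
      then show ?thesis
      proof cases
        case 1
        then show ?thesis by (simp add: coeff_X cG flip: power_Suc power_add mult.assoc)
      next
        case 3
        then show ?thesis by (simp add: coeff_X cG n_def coeff_eq_0)
      qed (simp add: coeff_X cG c_def n_def)
    qed
    then have XG: "X G = of_int (c ^ n) * h" by (simp add: poly_eq_iff del: of_int_power)
    obtain q' r where qr: "q = q' * G + r" "\<And>i. degree G \<le> i \<Longrightarrow> coeff r i = 0"
      using monic_division[OF G] by blast
    have "X q = pcompose q' [:0, c:] * X G + X r"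
      by (simp add: qr(1) X_def pcompose_add pcompose_mult algebra_simps)
    then have "u - X r = (u - X q) + pcompose q' [:0, c:] * of_int (c ^ n) * h"
      using XG by (simp add: mult.assoc)
    then have "u - X r \<in> I" using add_subgroup_add[OF Ig q Im[OF h(1)]] by metis
    then show ?thesis using qr(2) \<open>degree G = n\<close> by blast
  qed
  then have "\<exists>q. (\<forall>i\<ge>n. coeff q i = 0) \<and> of_int (c ^ N) * monom 1 j - X q \<in> I" for j :: nat
    using full by blast
  then obtain q where q: "\<And>j i. i \<ge> n \<Longrightarrow> coeff (q j) i = 0" "\<And>j. of_int (c ^ N) * monom 1 j - X (q j) \<in> I"
    by metis
  have "c ^ N > 0" using c by simp
  \<comment> \<open>Modulo c^N there are only finitely many polynomials of degree below n, so two of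
    the q j with j \<ge> n agree modulo c^N.\<close>
  define F where "F = {g :: int poly. (\<forall>i. coeff g i \<in> {0..<c ^ N}) \<and> (\<forall>i\<ge>n. coeff g i = 0)}"
  have "\<exists>y\<in>F. \<exists>v. q j = y + of_int (c ^ N) * v" for j
  proof -
    obtain y v where yv: "q j = y + of_int (c ^ N) * v" "\<And>i. coeff y i = coeff (q j) i mod (c ^ N)"
      using poly_reduce_mod[OF \<open>c ^ N > 0\<close>] by metis
    have "y \<in> F" using q(1) \<open>c ^ N > 0\<close> yv(2) unfolding F_def by (simp del: of_int_power)
    then show ?thesis using yv(1) by blast
  qed
  then obtain y v where yv: "\<And>j. y j \<in> F" "\<And>j. q j = y j + of_int (c ^ N) * v j" by metis
  have "finite F" unfolding F_def by (rule finite_bounded_polys)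
  then have "\<not> inj_on y {n..}"
    using finite_imageD[of y "{n..}"] finite_subset[of "y ` {n..}" F] yv(1) infinite_Ici by blast
  then obtain i0 j0 where "n \<le> i0" "n \<le> j0" "i0 \<noteq> j0" "y i0 = y j0" by (auto simp: inj_on_def)
  then obtain i j where ij: "n \<le> i" "i < j" "y i = y j" by (metis linorder_neqE_nat)
  define u where "u = v j - v i"
  have cu: "coeff u l = 0" if "l \<ge> n" for l
  proof -
    have "coeff (of_int (c ^ N) * v k) l = 0" for k
    proof -
      have "coeff (y k) l = 0" "coeff (q k) l = 0" using that q(1) yv(1)[of k] by (auto simp: F_def)
      then show ?thesis using yv(2)[of k] by (metis add_0 coeff_add)
    qed
    then show ?thesis using c by (simp add: u_def del: of_int_power)
  qed
  have Xc: "X (of_int d * z) = of_int d * X z" for d z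
    by (simp add: X_def of_int_poly pcompose_smult mult.commute)
  \<comment> \<open>c^N f' is the difference of the relations for j and i. As u has only terms below
    n \<le> i < j, the leading term of f' is x^j.\<close>
  define f' where "f' = monom 1 j - monom 1 i - X u"
  have "(of_int (c ^ N) * monom 1 j - X (q j)) - (of_int (c ^ N) * monom 1 i - X (q i)) \<in> I"
    by (rule add_subgroup_diff[OF Ig q(2) q(2)])
  also have "(of_int (c ^ N) * monom 1 j - X (q j)) - (of_int (c ^ N) * monom 1 i - X (q i))
    = of_int (c ^ N) * (monom 1 j - monom 1 i) - X (q j - q i)"
    by (simp add: X_diff algebra_simps)
  also have "q j - q i = of_int (c ^ N) * u" using yv(2)[of i] yv(2)[of j] ij(3) by (simp add: u_def algebra_simps)
  also have "of_int (c ^ N) * (monom 1 j - monom 1 i) - X (of_int (c ^ N) * u) = of_int (c ^ N) * f'"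
    unfolding Xc f'_def by (simp only: right_diff_distrib)
  finally have "meval a (of_int (c ^ N) * f') = 0" by (simp add: I_def)
  moreover have "lead_coeff f' = 1"
  proof -
    have cf: "coeff f' l = (if l = j then 1 else 0)" if "l \<ge> j" for l
      using that ij cu[of l] by (simp add: f'_def coeff_X)
    have "degree f' = j" by (rule antisym) (auto intro!: degree_le le_degree simp: cf)
    then show ?thesis using cf by simp
  qed
  ultimately show ?thesis using \<open>c ^ N > 0\<close> by blast
qed

lemma ex_squarefree_monic_multiple:
  assumes sep: "finitely_separable (zgen a)"
  shows "\<exists>k f. k > 0 \<and> squarefree k \<and> lead_coeff f = 1 \<and> meval a (of_int k * f) = 0"
proof -
  note I = submod_kernel_meval[of a]
  define Q where "Q m \<longleftrightarrow> m > 0 \<and> (\<exists>f. lead_coeff f = 1 \<and> meval a (of_int (int m) * f) = 0)" for m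
  obtain m0 f0 where "m0 > 0" "lead_coeff f0 = 1" "meval a (of_int m0 * f0) = 0"
    using ex_monic_multiple[OF sep] by blast
  then have ex: "Q (nat m0)" unfolding Q_def by (intro conjI exI[of _ f0]) auto
  define m where "m = (LEAST m. Q m)"
  have "Q m" unfolding m_def using ex by (rule LeastI)
  then obtain f where m: "m > 0" and f: "lead_coeff f = 1" "meval a (of_int (int m) * f) = 0" unfolding Q_def by blast
  have "squarefree (int m)"
  proof (rule ccontr)
    assume "\<not> squarefree (int m)"
    then obtain p :: int where p: "prime p" "p ^ 2 dvd int m"
      using squarefree_factorial_semiring[of "int m"] m by auto
    then obtain d where d: "int m = p ^ 2 * d" by (auto elim: dvdE)
    have "p > 1" using p(1) by (rule prime_gt_1_int)
    then have "d > 0" using m d by (metis of_nat_0_less_iff zero_less_mult_pos zero_less_power less_trans zero_less_one)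
    obtain g w where gw: "lead_coeff g = 1" "meval a (of_int p * g - of_int (p ^ 2) * w) = 0"
      using monic_mod_prime_square[OF sep p(1)] by blast
    \<comment> \<open>The factor \<open>x\<close>, a monomial of the degree of f, makes
      \<open>x * g\<close> dominate the remainder v, so that f' is monic.\<close>
    define x where "x = monom (1::int) (degree f)"
    obtain q v where qv: "x * w = q * f + v" "\<And>i. degree f \<le> i \<Longrightarrow> coeff v i = 0"
      using monic_division[OF f(1)] by blast
    define f' where "f' = x * g - of_int p * v"
    \<comment> \<open>With m = p^2 d, the summand q m f cancels the part q f of x w in d p^2 x w.
      What is left is (d p) f', and d p = m / p contradicts minimality.\<close>
    have "of_int d * x * (of_int p * g - of_int (p ^ 2) * w) + q * (of_int (int m) * f) \<in> {g. meval a g = 0}"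
      using submod_mult[OF I] gw(2) f(2) by (intro add_subgroup_add[OF submod_add_subgroup[OF I]]) blast+
    also have "of_int d * x * (of_int p * g - of_int (p ^ 2) * w) + q * (of_int (int m) * f)
      = of_int d * of_int p * (x * g) - of_int d * of_int p * of_int p * (x * w - q * f)"
      unfolding d by (simp add: algebra_simps power2_eq_square)
    also have "x * w - q * f = v" using qv(1) by simp
    also have "of_int d * of_int p * (x * g) - of_int d * of_int p * of_int p * v = of_int (d * p) * f'"
      by (simp add: f'_def algebra_simps)
    finally have "meval a (of_int (d * p) * f') = 0" by simp
    moreover have "lead_coeff f' = 1"
    proof -
      define D where "D = degree f + degree g"
      have cf: "coeff f' l = (if l = D then 1 else 0)" if "l \<ge> D" for l
        using that qv(2)[of l] gw(1) by (auto simp: f'_def x_def D_def coeff_monom_mult coeff_eq_0)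
      have "degree f' = D" by (rule antisym) (auto intro!: degree_le le_degree simp: cf)
      then show ?thesis using cf by simp
    qed
    ultimately have "Q (nat (d * p))" using \<open>d > 0\<close> \<open>p > 1\<close> unfolding Q_def by (intro conjI exI[of _ f']) auto
    then have "m \<le> nat (d * p)" unfolding m_def by (rule Least_le)
    then have "int m \<le> d * p" using m by linarith
    moreover have "d * p < int m" using \<open>d > 0\<close> \<open>p > 1\<close> unfolding d by (simp add: power2_eq_square)
    ultimately show False by simp
  qed
  then show ?thesis using m f by (intro exI[of _ "int m"] exI[of _ f]) auto
qed

theorem theorem1:
  fixes a :: "'a::ring"
  shows "finitely_separable (zgen a) \<longleftrightarrow>
    (\<exists>(k::int) (n::nat) (ks::nat \<Rightarrow> int). n > 0 \<and> k > 0 \<and> squarefree k \<and>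
       zsc k (apow a n + (\<Sum>i=1..n-1. zsc (ks i) (apow a (n - i)))) = 0)"
proof -
  have "finitely_separable (zgen a) \<longleftrightarrow>
    (\<exists>k>0. squarefree k \<and> (\<exists>f. lead_coeff f = 1 \<and> meval a (of_int k * f) = 0))"
    using finitely_separable_if ex_squarefree_monic_multiple by blast
  also have "\<dots> \<longleftrightarrow> (\<exists>k>0. squarefree k \<and>
      (\<exists>n>0. \<exists>ks. zsc k (apow a n + (\<Sum>i=1..n-1. zsc (ks i) (apow a (n - i)))) = 0))"
    unfolding meval_monic_iff ..
  finally show ?thesis by blast
qed

end
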